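(* Let $n\ge 1$, $1\le r\le n$, and let $b=u\otimes v\in B_A(\overline\Lambda_{2n-r}+\overline\Lambda_r)$, that is, $b$ is a semistandard tableau in the alphabet $[2n]$ with two columns $u$ (of height $2n-r$) and $v$ (of height $r$). Write $u_1=u|_{[n]}$, $u_2=u|_{[n+1,2n]}$, $v_1=v|_{[n]}$, $v_2=v|_{[n+1,2n]}$. With $V(\overline\Lambda_r)$ the virtual $U_q(C_n)$-crystal, the following are equivalent: 1. $b\in V(\overline\Lambda_r)$. 2. $\mathbb P(b^{\vee*})=b$, $u_1v_1$ is a tableau and $|u_1|-|v_1|=n-r$. 3. $\mathbb P(b^{\vee*})=b$, $u_2v_2$ is a tableau and $|u_2|-|v_2|=n-r$.
   Context: A column word is a strictly decreasing word; a semistandard tableau is identified with its column-reading word $c_1c_2\cdots$, $c_j$ the strictly decreasing word of the $j$-th column from the left; for column words $x,y$, "$xy$ is a tableau" means that the (top-justified) columns $x,y$ form a semistandard tableau. $w|_S$ is the subword of $w$ of letters in $S$; $|w|$ is the length of $w$. $\mathbb P(w)$ is the Schensted tableau of the word $w$ (the unique semistandard tableau Knuth equivalent to $w$; Knuth relations $xzy\sim zxy$ for $x\le y<z$ and $yzx\sim yxz$ for $x<y\le z$). For a column word $c$ in $[2n]$, $c^\vee$ is the column word whose letters are those of $[2n]$ not in $c$, and $c^*$ the column word obtained by replacing each letter $i$ by $2n+1-i$ and reversing. For $b=u\otimes v$ (identified with the word $uv$), $b^{\vee*}=u^{\vee*}\otimes v^{\vee*}$, identified with the word $u^{\vee*}v^{\vee*}$.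 Type $A_{2n-1}$ crystal operators: on letters, $f_i^A(i)=i+1$ ($1\le i\le 2n-1$), all other values $\varnothing$ (undefined); on words (tensor products of letters) by the rule $f_i(b_2\otimes b_1)=f_i(b_2)\otimes b_1$ if $\epsilon_i(b_2)\ge\varphi_i(b_1)$, $b_2\otimes f_i(b_1)$ otherwise, and $e_i(b_2\otimes b_1)=e_i(b_2)\otimes b_1$ if $\epsilon_i(b_2)>\varphi_i(b_1)$, $b_2\otimes e_i(b_1)$ otherwise; these preserve tableaux of a given shape. Virtual $U_q(C_n)$-operators: $e_i=e_{2n-i}^Ae_i^A$, $f_i=f_{2n-i}^Af_i^A$ for $1\le i\le n-1$, $e_n=(e_n^A)^2$, $f_n=(f_n^A)^2$. $V(\overline\Lambda_r)$ is the set of two-column tableaux with column heights $2n-r,r$ generated by the virtual operators $e_i,f_i$, $1\le i\le n$, from the tableau whose $i$-th row consists of letters $i$. *)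

theory Defs
  imports Main
begin

type_synonym word = "nat list"

definition column_word :: "word \<Rightarrow> bool" where
  "column_word c \<longleftrightarrow> sorted_wrt (>) c"

text \<open>A column word is read from bottom to top, so row \<open>i\<close> (counted from \<open>0\<close>, columns top-justified)
  of the column \<open>c\<close> is \<open>rev c ! i\<close>. The columns may be empty here.\<close>

definition two_column_tableau :: "word \<Rightarrow> word \<Rightarrow> bool" where
  "two_column_tableau x y \<longleftrightarrow> column_word x \<and> column_word y \<and> length y \<le> length x \<and>
     (\<forall>i<length y. rev x ! i \<le> rev y ! i)"

text \<open>Nonempty columns make the list of columns recoverable from its concatenation: the columns are
  the maximal strictly decreasing factors of the word.\<close>

definition tableau_columns :: "word list \<Rightarrow> bool" where
  "tableau_columns cs \<longleftrightarrow> (\<forall>c\<in>set cs. c \<noteq> [] \<and> column_word c) \<and> successively two_column_tableau cs"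

definition tableau :: "word \<Rightarrow> bool" where
  "tableau w \<longleftrightarrow> (\<exists>cs. tableau_columns cs \<and> w = concat cs)"

definition subword :: "nat set \<Rightarrow> word \<Rightarrow> word" where
  "subword S w = filter (\<lambda>x. x \<in> S) w"

inductive knuth_step :: "word \<Rightarrow> word \<Rightarrow> bool" where
  "x \<le> y \<Longrightarrow> y < z \<Longrightarrow> knuth_step (p @ [x, z, y] @ q) (p @ [z, x, y] @ q)"
| "x < y \<Longrightarrow> y \<le> z \<Longrightarrow> knuth_step (p @ [y, z, x] @ q) (p @ [y, x, z] @ q)"

definition knuth_equivalent :: "word \<Rightarrow> word \<Rightarrow> bool" where
  "knuth_equivalent = equivclp knuth_step"

definition schensted_tableau :: "word \<Rightarrow> word" (\<open>\<bbbP>\<close>) where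
  "\<bbbP> w = (THE t. tableau t \<and> knuth_equivalent w t)"

text \<open>\<open>vee n c\<close> and \<open>star n c\<close> are \<open>c\<^sup>\<or>\<close> and \<open>c\<^sup>*\<close> for a column word \<open>c\<close> in \<open>[2n]\<close>.\<close>

definition vee :: "nat \<Rightarrow> word \<Rightarrow> word" where
  "vee n c = rev (sorted_list_of_set ({1..2 * n} - set c))"

definition star :: "nat \<Rightarrow> word \<Rightarrow> word" where
  "star n c = rev (map (\<lambda>i. 2 * n + 1 - i) c)"

text \<open>The value \<open>None\<close> stands for an undefined operator (\<open>\<emptyset>\<close>).\<close>

definition iterate :: "('a \<Rightarrow> 'a option) \<Rightarrow> nat \<Rightarrow> 'a \<Rightarrow> 'a option" where
  "iterate g k b = ((\<lambda>y. Option.bind y g) ^^ k) (Some b)"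

text \<open>For \<open>g = e\<^sub>i\<close> this is \<open>\<epsilon>\<^sub>i\<close>, for \<open>g = f\<^sub>i\<close> it is \<open>\<phi>\<^sub>i\<close>.\<close>

definition string_length :: "('a \<Rightarrow> 'a option) \<Rightarrow> 'a \<Rightarrow> nat" where
  "string_length g b = (GREATEST k. iterate g k b \<noteq> None)"

definition f_letter :: "nat \<Rightarrow> nat \<Rightarrow> nat option" where
  "f_letter i x = (if x = i then Some (i + 1) else None)"

definition e_letter :: "nat \<Rightarrow> nat \<Rightarrow> nat option" where
  "e_letter i x = (if x = i + 1 then Some i else None)"

text \<open>A nonempty word \<open>x # v\<close> is the tensor product \<open>x \<otimes> v\<close> (the tensor product of crystals is
  associative, so bracketing to the right is no restriction). The tensor product rule for \<open>x \<otimes> v\<close>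
  uses \<open>\<phi>\<^sub>i(v)\<close>, that is, all powers of \<open>f\<^sub>i\<close> at \<open>v\<close>, so \<open>f\<^sub>i\<close> is defined simultaneously for all words
  of a given length; \<open>fA_Cons\<close> below is the rule itself.\<close>

primrec fA_len :: "nat \<Rightarrow> nat \<Rightarrow> word \<Rightarrow> word option" where
  "fA_len i 0 w = None"
| "fA_len i (Suc m) w = (case w of [] \<Rightarrow> None | x # v \<Rightarrow>
     if string_length (e_letter i) x \<ge> string_length (fA_len i m) v
     then map_option (\<lambda>y. y # v) (f_letter i x)
     else map_option (\<lambda>v'. x # v') (fA_len i m v))"

definition fA :: "nat \<Rightarrow> word \<Rightarrow> word option" where
  "fA i w = fA_len i (length w) w"

primrec eA :: "nat \<Rightarrow> word \<Rightarrow> word option" where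
  "eA i [] = None"
| "eA i (x # v) =
     (if string_length (e_letter i) x > string_length (fA i) v
      then map_option (\<lambda>y. y # v) (e_letter i x)
      else map_option (\<lambda>v'. x # v') (eA i v))"

lemma fA_len_length: "fA_len i m w = Some w' \<Longrightarrow> length w' = length w"
  by (induction m arbitrary: w w') (auto split: list.splits if_splits)

lemma fA_length: "fA i w = Some w' \<Longrightarrow> length w' = length w"
  by (simp add: fA_def fA_len_length)

lemma iterate_Suc: "iterate g (Suc k) b = Option.bind (iterate g k b) g"
  by (simp add: iterate_def)

lemma iterate_fA_len:
  "iterate (fA_len i (length v)) k v = iterate (fA i) k v \<and>
   (\<forall>v'. iterate (fA i) k v = Some v' \<longrightarrow> length v' = length v)"
proof (induction k)
  case 0
  then show ?case by (simp add: iterate_def)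
next
  case (Suc k)
  then show ?case
  proof (cases "iterate (fA i) k v")
    case None
    with Suc show ?thesis by (simp add: iterate_Suc)
  next
    case (Some a)
    with Suc have a: "length a = length v" by blast
    then have "fA i a = fA_len i (length v) a" by (simp add: fA_def)
    moreover have "length v' = length v" if "fA i a = Some v'" for v'
      using fA_length[OF that] a by simp
    ultimately show ?thesis using Suc Some by (simp add: iterate_Suc)
  qed
qed

lemma fA_Nil: "fA i [] = None"
  by (simp add: fA_def)

lemma fA_Cons:
  "fA i (x # v) =
     (if string_length (e_letter i) x \<ge> string_length (fA i) v
      then map_option (\<lambda>y. y # v) (f_letter i x)
      else map_option (\<lambda>v'. x # v') (fA i v))"
proof -
  have "string_length (fA_len i (length v)) v = string_length (fA i) v"
    by (simp add: string_length_def iterate_fA_len)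
  then show ?thesis by (simp add: fA_def)
qed

definition eC :: "nat \<Rightarrow> nat \<Rightarrow> word \<Rightarrow> word option" where
  "eC n i w = (if i < n then Option.bind (eA i w) (eA (2 * n - i))
               else Option.bind (eA n w) (eA n))"

definition fC :: "nat \<Rightarrow> nat \<Rightarrow> word \<Rightarrow> word option" where
  "fC n i w = (if i < n then Option.bind (fA i w) (fA (2 * n - i))
               else Option.bind (fA n w) (fA n))"

text \<open>The tableau with columns of heights \<open>2n-r\<close> and \<open>r\<close> whose \<open>i\<close>-th row consists of letters \<open>i\<close>.\<close>

definition yamanouchi :: "nat \<Rightarrow> nat \<Rightarrow> word" where
  "yamanouchi n r = rev [1..<2 * n - r + 1] @ rev [1..<r + 1]"

inductive_set virtual_crystal :: "nat \<Rightarrow> nat \<Rightarrow> word set" for n r where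
  "yamanouchi n r \<in> virtual_crystal n r"
| "w \<in> virtual_crystal n r \<Longrightarrow> i \<in> {1..n} \<Longrightarrow> eC n i w = Some w' \<Longrightarrow> w' \<in> virtual_crystal n r"
| "w \<in> virtual_crystal n r \<Longrightarrow> i \<in> {1..n} \<Longrightarrow> fC n i w = Some w' \<Longrightarrow> w' \<in> virtual_crystal n r"

end

theory Submission
  imports Defs
begin

text \<open>
  A two-column tableau is a sequence of brackets indexed by the alphabet \<open>1, \<dots>, 2n\<close>: a letter that
  occurs only in the left column opens a bracket, one that occurs only in the right column closes one, and
  letters in both columns or in none are neutral. The tableau condition says that every closing
  bracket is matched, and \<open>2n - 2r\<close> opening brackets stay unmatched.

  The word \<open>b\<^sup>\<or>\<^sup>*\<close> has columns of heights \<open>r\<close> and \<open>2n - r\<close>. Taking complements exchanges opening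
  and closing brackets as well as the two kinds of neutral letters, and reversing the alphabet turns
  the sequence around; so \<open>b\<^sup>\<or>\<^sup>*\<close> is the mirror image of the bracket sequence of \<open>b\<close>, with the
  unmatched letters in the right column. Moving the unmatched letters to the left column does not
  change the Knuth class: inserting the left column into the right one bumps exactly those
  letters of the right column that are not unmatched (\<open>slide_knuth\<close>). Since a Knuth class contains only one tableau
  (\<open>schensted_tableau_eqI\<close>), \<open>\<bbbP> (b\<^sup>\<or>\<^sup>*)\<close> is the tableau of the mirrored sequence
  (\<open>schensted_tableau_vee_star\<close>). Hence \<open>\<bbbP> (b\<^sup>\<or>\<^sup>*) = b\<close> iff the bracket sequence is symmetric.

  For a symmetric sequence, half of the unmatched brackets, namely \<open>n - r\<close>, lie in the first half of the
  alphabet, so \<open>|u\<^sub>1| - |v\<^sub>1|\<close> is \<open>n - r\<close> plus the number of matched pairs that cross the middle, and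
  \<open>|u\<^sub>2| - |v\<^sub>2|\<close> is \<open>n - r\<close> minus that number. Both conditions on lengths therefore say that no pair
  crosses the middle. In this case the second half has no unmatched closing bracket, so its
  columns form a tableau; those of the first half always do.

  The symmetric sequences without crossing pairs are determined by their first half. There the virtual
  operators with \<open>i < n\<close> act as type \<open>A\<close> operators, which exchange neighbouring symbols or create or
  remove a matched pair, and the operator for \<open>n\<close> switches the letter \<open>n\<close> between lying in both columns and in
  none (\<open>virtual_word_closed\<close>). So these sequences are closed under the operators, and each of them can be
  traced back to the highest weight tableau, since some raising move is possible at every other sequence
  (\<open>virtual_seq_raise\<close>). They thus form the virtual crystal (\<open>virtual_crystal_symbols\<close>).
\<close>

section \<open>Knuth equivalence\<close>

lemma knuth_equivalent_refl [simp]: "knuth_equivalent w w"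
  by (simp add: knuth_equivalent_def)

lemma knuth_equivalent_sym: "knuth_equivalent w w' \<Longrightarrow> knuth_equivalent w' w"
  by (simp add: knuth_equivalent_def equivclp_sym)

lemma knuth_equivalent_trans [trans]:
  "knuth_equivalent w w' \<Longrightarrow> knuth_equivalent w' w'' \<Longrightarrow> knuth_equivalent w w''"
  unfolding knuth_equivalent_def by (rule equivclp_trans)

lemma knuth_step_equivalent: "knuth_step w w' \<Longrightarrow> knuth_equivalent w w'"
  by (auto simp: knuth_equivalent_def)

lemma knuth_step_context: "knuth_step w w' \<Longrightarrow> knuth_step (p @ w @ q) (p @ w' @ q)"
proof (induction rule: knuth_step.induct)
  case (1 x y z p' q')
  then show ?case using knuth_step.intros(1)[of x y z "p @ p'" "q' @ q"] by simp
next
  case (2 x y z p' q')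
  then show ?case using knuth_step.intros(2)[of x y z "p @ p'" "q' @ q"] by simp
qed

lemma knuth_equivalent_context:
  assumes "knuth_equivalent w w'"
  shows "knuth_equivalent (p @ w @ q) (p @ w' @ q)"
  using assms[unfolded knuth_equivalent_def]
proof (induction rule: equivclp_induct)
  case base
  then show ?case by simp
next
  case (step y z)
  then show ?case
    by (meson knuth_equivalent_sym knuth_equivalent_trans knuth_step_context knuth_step_equivalent)
qed

lemma knuth_equivalent_invariant:
  assumes "\<And>w w'. knuth_step w w' \<Longrightarrow> F w = F w'" and "knuth_equivalent w w'"
  shows "F w = F w'"
  using assms(2)[unfolded knuth_equivalent_def]
  by (induction rule: equivclp_induct) (auto dest: assms(1))

lemma knuth_equivalent_length: "knuth_equivalent w w' \<Longrightarrow> length w = length w'"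
  by (rule knuth_equivalent_invariant[where F = length]) (auto elim: knuth_step.cases)

lemma knuth1: "x \<le> y \<Longrightarrow> y < z \<Longrightarrow> knuth_equivalent (x # z # y # q) (z # x # y # q)"
  using knuth_step.intros(1)[of x y z "[]" q] by (simp add: knuth_step_equivalent)

lemma knuth2: "x < y \<Longrightarrow> y \<le> z \<Longrightarrow> knuth_equivalent (y # z # x # q) (y # x # z # q)"
  using knuth_step.intros(2)[of x y z "[]" q] by (simp add: knuth_step_equivalent)

section \<open>Uniqueness of the tableau in a Knuth class\<close>

text \<open>Column insertion. A column is kept as the increasing list of its letters, from top to bottom; the
  second component is the word of bumped letters, of length at most one.\<close>
fun insert_letter :: "nat \<Rightarrow> nat list \<Rightarrow> nat list \<times> word" where
  "insert_letter x [] = ([x], [])"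
| "insert_letter x (c # cs) =
     (if x \<le> c then (x # cs, [c])
      else (c # fst (insert_letter x cs), snd (insert_letter x cs)))"

text \<open>The letters are inserted from right to left and bumped letters are collected in the same order,
  so that the word of bumped letters is the one to be inserted into the next column.\<close>
fun insert_word :: "word \<Rightarrow> nat list \<Rightarrow> nat list \<times> word" where
  "insert_word [] C = (C, [])"
| "insert_word (x # w) C =
     (fst (insert_letter x (fst (insert_word w C))),
      snd (insert_letter x (fst (insert_word w C))) @ snd (insert_word w C))"

lemma insert_word_append:
  "insert_word (p @ w) C =
     (fst (insert_word p (fst (insert_word w C))),
      snd (insert_word p (fst (insert_word w C))) @ snd (insert_word w C))"
  by (induction p) auto

lemma set_insert_letter: "set (fst (insert_letter x C)) \<subseteq> insert x (set C)"
  by (induction C) auto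

lemma sorted_insert_letter:
  "sorted_wrt (<) C \<Longrightarrow> sorted_wrt (<) (fst (insert_letter x C))"
proof (induction C)
  case (Cons c C)
  then show ?case using set_insert_letter[of x C] by fastforce
qed simp

lemma sorted_insert_word:
  "sorted_wrt (<) C \<Longrightarrow> sorted_wrt (<) (fst (insert_word w C))"
  by (induction w) (auto simp: sorted_insert_letter)

lemma snd_insert_letter:
  "snd (insert_letter x C) = [] \<or> (\<exists>y\<in>set C. x \<le> y \<and> snd (insert_letter x C) = [y])"
  by (induction C) auto

text \<open>Once \<open>y\<close> has replaced the bumped letter \<open>y'\<close>, every letter of the column above \<open>y\<close> exceeds \<open>y'\<close>, and
  \<open>z\<close> can only bump one of these.\<close>
lemma insert_letter_pair_bumps:
  assumes "sorted_wrt (<) C" and "y < z" and "snd (insert_letter z (fst (insert_letter y C))) = [z']"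
  shows "\<exists>y'. snd (insert_letter y C) = [y'] \<and> y \<le> y' \<and> y' < z'"
  using assms
proof (induction C)
  case (Cons c C)
  show ?case
  proof (cases "y \<le> c")
    case True
    with Cons.prems show ?thesis using snd_insert_letter[of z C] by (auto)
  next
    case False
    with Cons show ?thesis by (auto split: if_splits)
  qed
qed simp

text \<open>Away from the smallest letter of the column the claim passes to the rest of the column. If that
  letter is bumped, then the bumped words are equal or differ by the first Knuth relation again.\<close>
lemma insert_word_knuth1:
  assumes "x \<le> y" "y < z" "sorted_wrt (<) C"
  shows "fst (insert_word [x, z, y] C) = fst (insert_word [z, x, y] C) \<and>
    knuth_equivalent (snd (insert_word [x, z, y] C)) (snd (insert_word [z, x, y] C))"
  using assms(3)
proof (induction C)
  case Nil
  then show ?case using assms by simp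
next
  case (Cons c C)
  consider "c < x" | "x \<le> c" "y \<le> c" | "x \<le> c" "c < y" by linarith
  then show ?case
  proof cases
    case 1
    then show ?thesis using Cons assms by auto
  next
    case 2
    show ?thesis using snd_insert_letter[of z C] 2 Cons.prems assms(1,2) 
      by (auto intro!: knuth1)
  next
    case 3
    let ?C = "fst (insert_letter y C)"
    have "snd (insert_letter z ?C) = [] \<or> (\<exists>z' y'. snd (insert_letter z ?C) = [z'] \<and>
      snd (insert_letter y C) = [y'] \<and> y \<le> y' \<and> y' < z')"
      using insert_letter_pair_bumps[of C y z] snd_insert_letter[of z ?C] Cons.prems assms(2) by auto
    then show ?thesis using 3 assms(1,2) by (auto intro!: knuth1)
  qed
qed

text \<open>Here the two orders of insertion can interfere: if \<open>x\<close> and \<open>z\<close> would bump the same letter \<open>c\<close>, then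
  the bumped words are equal or differ by the first Knuth relation, with \<open>z \<le> c\<close> in the role of
  \<open>x \<le> y\<close>. Otherwise they are equal or differ by the second one.\<close>
lemma insert_word_knuth2:
  assumes "x < y" "y \<le> z" "sorted_wrt (<) C"
  shows "fst (insert_word [y, z, x] C) = fst (insert_word [y, x, z] C) \<and>
    knuth_equivalent (snd (insert_word [y, z, x] C)) (snd (insert_word [y, x, z] C))"
  using assms(3)
proof (induction C)
  case Nil
  then show ?case using assms by simp
next
  case (Cons c C)
  consider "c < x" | "x \<le> c" "c < z" | "x \<le> c" "z \<le> c" by linarith
  then show ?case
  proof cases
    case 1
    then show ?thesis using Cons assms by auto
  next
    case 2
    let ?C = "fst (insert_letter z C)"
    have "snd (insert_letter z C) = [] \<or> (\<exists>z'. snd (insert_letter z C) = [z'] \<and> z \<le> z')"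
      using snd_insert_letter[of z C] by auto
    moreover have "\<exists>y'. snd (insert_letter y ?C) = [y'] \<and> c < y' \<and> y' \<le> z"
      using Cons.prems 2 assms(2)
      by (induction C) auto
    ultimately show ?thesis using 2 assms(1,2) by (auto intro!: knuth2)
  next
    case 3
    show ?thesis
    proof (cases C)
      case Nil
      then show ?thesis using 3 assms by auto
    next
      case C: (Cons d D)
      then show ?thesis using 3 assms Cons.prems by (auto intro!: knuth1)
    qed
  qed
qed

lemma insert_word_knuth_step:
  assumes "knuth_step w w'"
  shows "fst (insert_word w []) = fst (insert_word w' []) \<and>
    knuth_equivalent (snd (insert_word w [])) (snd (insert_word w' []))"
proof -
  have lift: "fst (insert_word (p @ m @ q) []) = fst (insert_word (p @ m' @ q) []) \<and>
      knuth_equivalent (snd (insert_word (p @ m @ q) [])) (snd (insert_word (p @ m' @ q) []))"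
    if "\<And>C. sorted_wrt (<) C \<Longrightarrow> fst (insert_word m C) = fst (insert_word m' C) \<and>
      knuth_equivalent (snd (insert_word m C)) (snd (insert_word m' C))" for p m m' q
    using that[of "fst (insert_word q [])"] sorted_insert_word[of "[]" q]
    by (simp add: insert_word_append knuth_equivalent_context)
  show ?thesis
    using assms
  proof cases
    case (1 x y z p q)
    then show ?thesis
      using lift[of "[x, z, y]" "[z, x, y]" p q, OF insert_word_knuth1[of x y z]] by simp
  next
    case (2 x y z p q)
    then show ?thesis
      using lift[of "[y, z, x]" "[y, x, z]" p q, OF insert_word_knuth2[of x y z]] by simp
  qed
qed

text \<open>The first column is a Knuth invariant, and so is the Knuth class of what is bumped out of it. This
  makes an induction on the number of columns possible.\<close>
lemma insert_word_knuth_equivalent: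
  assumes "knuth_equivalent w w'"
  shows "fst (insert_word w []) = fst (insert_word w' []) \<and>
    knuth_equivalent (snd (insert_word w [])) (snd (insert_word w' []))"
  using assms[unfolded knuth_equivalent_def]
proof (induction rule: equivclp_induct)
  case base
  then show ?case by simp
next
  case (step y z)
  have "fst (insert_word y []) = fst (insert_word z []) \<and>
      knuth_equivalent (snd (insert_word y [])) (snd (insert_word z []))"
    using step(2) insert_word_knuth_step[of y z] insert_word_knuth_step[of z y]
      knuth_equivalent_sym by auto
  with step(3) show ?case
    using knuth_equivalent_trans by auto
qed

lemma insert_letter_above:
  "\<forall>e\<in>set E. e < x \<Longrightarrow> insert_letter x (E @ D) =
     (E @ fst (insert_letter x D), snd (insert_letter x D))"
  by (induction E) auto

text \<open>The column \<open>a\<close> is inserted in increasing order, and each of its letters bumps the letter in the same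
  row of \<open>D\<close>, if there is one. The part \<open>E\<close> of the column consists of the letters that have been inserted already.\<close>
lemma insert_column:
  assumes "sorted_wrt (<) (E @ a)" "length D \<le> length a" "\<forall>i<length D. a ! i \<le> D ! i"
  shows "insert_word (rev a) (E @ D) = (E @ a, rev D)"
  using assms
proof (induction a arbitrary: E D)
  case Nil
  then show ?case by simp
next
  case (Cons x a)
  have E: "\<forall>e\<in>set E. e < x" using Cons.prems(1) by (auto simp: sorted_wrt_append)
  show ?case
  proof (cases D)
    case Nil
    have "insert_word (rev a) ((E @ [x]) @ []) = ((E @ [x]) @ a, rev [])"
      by (rule Cons.IH) (use Cons.prems in auto)
    then show ?thesis using insert_letter_above[OF E, of "[]"] Nil
      by (simp add: insert_word_append)
  next
    case D: (Cons d D')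
    have "\<forall>i<length D'. a ! i \<le> D' ! i"
      using Cons.prems(3) D by fastforce
    then have "insert_word (rev a) ((E @ [x]) @ D') = ((E @ [x]) @ a, rev D')"
      by (intro Cons.IH) (use Cons.prems D in auto)
    moreover have "x \<le> d" using Cons.prems(3) D by force
    ultimately show ?thesis using E D by (simp add: insert_word_append insert_letter_above)
  qed
qed

lemma column_word_rev: "column_word c \<longleftrightarrow> sorted_wrt (<) (rev c)"
  by (simp add: column_word_def sorted_wrt_rev)

lemma insert_tableau:
  "tableau_columns (c # cs) \<Longrightarrow> insert_word (concat (c # cs)) [] = (rev c, concat cs)"
proof (induction cs arbitrary: c)
  case Nil
  then show ?case
    using insert_column[of "[]" "rev c" "[]"] by (simp add: tableau_columns_def column_word_rev)
next
  case (Cons d cs)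
  then have "insert_word (concat (d # cs)) [] = (rev d, concat cs)"
    by (simp add: tableau_columns_def)
  moreover have "two_column_tableau c d" using Cons.prems by (simp add: tableau_columns_def)
  then have "insert_word c (rev d) = (rev c, d)"
    using insert_column[of "[]" "rev c" "rev d"]
    by (simp add: two_column_tableau_def column_word_rev)
  ultimately show ?case
    by (simp only: concat.simps(2)[of c] insert_word_append) simp
qed

lemma tableau_columns_unique:
  assumes "tableau_columns cs" "tableau_columns cs'" "knuth_equivalent (concat cs) (concat cs')"
  shows "cs = cs'"
  using assms
proof (induction cs arbitrary: cs')
  case Nil
  then show ?case using knuth_equivalent_length[OF Nil(3)] by (cases cs') (auto simp: tableau_columns_def)
next
  case (Cons c cs)
  show ?case
  proof (cases cs')
    case Nil
    then show ?thesis using Cons.prems knuth_equivalent_length[OF Cons.prems(3)]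
      by (auto simp: tableau_columns_def)
  next
    case cs': (Cons c' cs'')
    have "insert_word (concat cs') [] = (rev c', concat cs'')"
      using insert_tableau Cons.prems(2) unfolding cs' by blast
    then have "rev c = rev c'" "knuth_equivalent (concat cs) (concat cs'')"
      using insert_word_knuth_equivalent[OF Cons.prems(3)]
      unfolding insert_tableau[OF Cons.prems(1)] by simp_all
    moreover have "tableau_columns cs" "tableau_columns cs''"
      using Cons.prems cs' by (auto simp: tableau_columns_def successively_Cons)
    ultimately show ?thesis using Cons.IH[of cs''] cs' by simp
  qed
qed

lemma schensted_tableau_eqI:
  assumes "tableau t" "knuth_equivalent w t"
  shows "\<bbbP> w = t"
  unfolding schensted_tableau_def
proof (rule the_equality)
  show "tableau t \<and> knuth_equivalent w t" using assms by simp
next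
  fix t' assume t': "tableau t' \<and> knuth_equivalent w t'"
  then obtain cs' where cs': "tableau_columns cs'" "t' = concat cs'"
    by (auto simp: tableau_def)
  obtain cs where cs: "tableau_columns cs" "t = concat cs"
    using assms(1) by (auto simp: tableau_def)
  have "knuth_equivalent t' t"
    using t' assms(2) knuth_equivalent_sym knuth_equivalent_trans by blast
  then show "t' = t"
    using tableau_columns_unique[OF cs'(1) cs(1)] cs cs' by simp
qed

section \<open>Column insertion as a Knuth equivalence\<close>

text \<open>The letter \<open>y\<close> passes the letters \<open>q\<close> of \<open>Q\<close> one by one. Each time the second Knuth relation applies
  to \<open>q < d \<le> y\<close>, and then \<open>q\<close> takes the role of \<open>d\<close>.\<close>
lemma bump_below:
  assumes "sorted_wrt (>) (d # Q)" "d \<le> y" "\<forall>q\<in>set Q. q < y"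
  shows "knuth_equivalent (d # y # Q) (d # Q @ [y])"
  using assms
proof (induction Q arbitrary: d)
  case Nil
  then show ?case by simp
next
  case (Cons q Q)
  have "knuth_equivalent (d # y # q # Q) (d # q # y # Q)"
    using Cons.prems by (intro knuth2) auto
  also have "knuth_equivalent \<dots> (d # q # Q @ [y])"
    using knuth_equivalent_context[of "q # y # Q" "q # Q @ [y]" "[d]" "[]"] Cons by auto
  finally show ?case by simp
qed

text \<open>One step of column insertion as a Knuth equivalence: \<open>x\<close> enters the column and the bumped letter \<open>y\<close>
  leaves it on the right. The letter \<open>x\<close> first passes the letters above \<open>y\<close>; then \<open>y\<close> passes the letters
  below \<open>x\<close>.\<close>
lemma column_bump:
  assumes "sorted_wrt (>) (P @ y # Q)" "x \<le> y" "\<forall>q\<in>set Q. q < x"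
  shows "knuth_equivalent (x # P @ y # Q) (P @ x # Q @ [y])"
  using assms
proof (induction P)
  case Nil
  then show ?case using bump_below[of x Q y] by auto
next
  case (Cons p P)
  \<comment> \<open>the letter that \<open>x\<close> meets after \<open>p\<close> is the next one of \<open>P\<close>, or \<open>y\<close>\<close>
  define z R where "z = hd (P @ y # Q)" and "R = tl (P @ y # Q)"
  have zR: "P @ y # Q = z # R" by (simp add: z_def R_def)
  have "z \<in> set (P @ y # Q)" using zR by simp
  then have "z < p" using Cons.prems(1) by auto
  have "x \<le> z"
  proof (cases P)
    case Nil
    then show ?thesis using zR Cons.prems(2) by simp
  next
    case P: (Cons p' P')
    then have "y \<in> set R" "\<forall>q\<in>set R. q < z" using zR Cons.prems(1) by auto
    then have "y < z" by simp
    then show ?thesis using Cons.prems(2) by simp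
  qed
  with \<open>z < p\<close> have "knuth_equivalent (x # (p # P) @ y # Q) (p # x # P @ y # Q)"
    using knuth1[of x z p R] zR by simp
  also have "knuth_equivalent \<dots> (p # P @ x # Q @ [y])"
    using knuth_equivalent_context[of "x # P @ y # Q" "P @ x # Q @ [y]" "[p]" "[]"] Cons by auto
  finally show ?case by simp
qed

section \<open>Two columns as a bracketed sequence\<close>

text \<open>A pair of columns is read off letter by letter: a letter lies in both columns, in neither of them,
  only in the left one, or only in the right one. In the last two cases the letter is an opening or a
  closing bracket; \<open>Open\<close> is a matched opening bracket, whereas \<open>Free\<close> is an opening bracket that is
  never closed. The columns form a tableau iff every closing bracket is matched.\<close>
datatype symbol = Both | Neither | Open | Close | Free

primrec step :: "symbol \<Rightarrow> nat \<Rightarrow> nat option" where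
  "step Both h = Some h"
| "step Neither h = Some h"
| "step Open h = Some (Suc h)"
| "step Close h = (if h = 0 then None else Some (h - 1))"
| "step Free h = (if h = 0 then Some 0 else None)"

text \<open>The number of brackets that are still open. An unmatched bracket can only occur where no matched
  bracket is open, so that \<open>height 0 s = Some 0\<close> says that \<open>s\<close> is correctly bracketed and that exactly
  the unmatched letters carry the label \<open>Free\<close>.\<close>
primrec height :: "nat \<Rightarrow> symbol list \<Rightarrow> nat option" where
  "height h [] = Some h"
| "height h (x # s) = Option.bind (step x h) (\<lambda>k. height k s)"

lemma height_append: "height h (s @ t) = Option.bind (height h s) (\<lambda>k. height k t)"
  by (induction s arbitrary: h) (auto split: bind_splits)

primrec letters :: "nat \<Rightarrow> bool list \<Rightarrow> nat list" where
  "letters k [] = []"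
| "letters k (b # bs) = (if b then k # letters (Suc k) bs else letters (Suc k) bs)"

lemma letters_append: "letters k (as @ bs) = letters k as @ letters (k + length as) bs"
  by (induction as arbitrary: k) auto

lemma set_letters: "set (letters k bs) \<subseteq> {k..<k + length bs}"
proof (induction bs arbitrary: k)
  case (Cons b bs)
  have "set (letters (Suc k) bs) \<subseteq> {Suc k..<Suc k + length bs}" by (rule Cons.IH)
  also have "\<dots> \<subseteq> {k..<k + length (b # bs)}" by auto
  finally show ?case by auto
qed simp

lemma letters_ge: "x \<in> set (letters k bs) \<Longrightarrow> k \<le> x"
  using set_letters by fastforce

lemma letters_lt: "x \<in> set (letters k bs) \<Longrightarrow> x < k + length bs"
  using set_letters by fastforce

lemma sorted_letters: "sorted_wrt (<) (letters k bs)"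
  by (induction bs arbitrary: k) (auto dest: letters_ge)

lemma column_word_letters: "column_word (rev (letters k bs))"
  by (simp add: column_word_rev sorted_letters)

lemma letters_inject:
  "length bs = length bs' \<Longrightarrow> letters k bs = letters k bs' \<longleftrightarrow> bs = bs'"
proof (induction bs bs' arbitrary: k rule: list_induct2)
  case (Cons b bs b' bs')
  then show ?case using letters_ge[of k "Suc k"] by (auto; metis list.set_intros(1) not_less_eq_eq order_refl)
qed simp

fun in_left :: "symbol \<Rightarrow> bool" where
  "in_left Neither = False"
| "in_left Close = False"
| "in_left _ = True"

fun in_right :: "symbol \<Rightarrow> bool" where
  "in_right Both = True"
| "in_right Close = True"
| "in_right _ = False"

text \<open>The pair of columns that results from sliding all \<open>Free\<close> letters from the left to the right column.\<close>
fun slid_left :: "symbol \<Rightarrow> bool" where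
  "slid_left Both = True"
| "slid_left Open = True"
| "slid_left _ = False"

fun slid_right :: "symbol \<Rightarrow> bool" where
  "slid_right Neither = False"
| "slid_right Open = False"
| "slid_right _ = True"

definition two_columns :: "symbol list \<Rightarrow> word" where
  "two_columns s = rev (letters 1 (map in_left s)) @ rev (letters 1 (map in_right s))"

definition slid_columns :: "symbol list \<Rightarrow> word" where
  "slid_columns s = rev (letters 1 (map slid_left s)) @ rev (letters 1 (map slid_right s))"

text \<open>With \<open>h\<close> open brackets, the next \<open>h\<close> letters of the right column come before any \<open>Free\<close> letter, hence
  are not affected by the sliding.\<close>
lemma height_take:
  "height h s = Some 0 \<Longrightarrow>
     h \<le> length (letters k (map in_right s)) \<and>
     take h (letters k (map slid_right s)) = take h (letters k (map in_right s))"
proof (induction s arbitrary: h k)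
  case (Cons x s)
  show ?case
  proof (cases h)
    case 0
    then show ?thesis by simp
  next
    case (Suc g)
    have IH: "height h' s = Some 0 \<Longrightarrow>
      h' \<le> length (letters (Suc k) (map in_right s)) \<and>
      take h' (letters (Suc k) (map slid_right s)) = take h' (letters (Suc k) (map in_right s))" for h'
      by (rule Cons.IH)
    show ?thesis
    proof (cases x)
      case Both
      then have "height (Suc g) s = Some 0" using Cons.prems Suc by simp
      from IH[OF this] have a: "Suc g \<le> length (letters (Suc k) (map in_right s))"
        and "take g (take (Suc g) (letters (Suc k) (map slid_right s)))
          = take g (take (Suc g) (letters (Suc k) (map in_right s)))" by auto
      then show ?thesis using Both Suc by simp
    next
      case Open
      then have "height (Suc h) s = Some 0" using Cons.prems Suc by simp
      from IH[OF this] have "Suc h \<le> length (letters (Suc k) (map in_right s))"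
        and "take h (take (Suc h) (letters (Suc k) (map slid_right s)))
          = take h (take (Suc h) (letters (Suc k) (map in_right s)))" by auto
      then show ?thesis using Open by simp
    qed (use Suc Cons.prems IH[of h] IH[of g] in auto)
  qed
qed simp

lemma height_Suc_drop:
  assumes "height (Suc h) s = Some 0"
  obtains y where "drop h (letters k (map slid_right s)) = y # drop (Suc h) (letters k (map slid_right s))"
    and "drop h (letters k (map in_right s)) = y # drop (Suc h) (letters k (map in_right s))"
    and "k \<le> y"
proof -
  let ?Y = "letters k (map slid_right s)" and ?V = "letters k (map in_right s)"
  have V: "Suc h \<le> length ?V" and eq: "take (Suc h) ?Y = take (Suc h) ?V"
    using height_take[OF assms, of k] by auto
  then have Y: "Suc h \<le> length ?Y"
    by (metis length_take min.absorb2 min.orderI min.commute)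
  have "?Y ! h = ?V ! h" using arg_cong[OF eq, of "\<lambda>l. l ! h"] by simp
  moreover have "k \<le> ?V ! h" using V letters_ge[OF nth_mem, of h k "map in_right s"] by simp
  moreover have "drop h ?Y = ?Y ! h # drop (Suc h) ?Y" "drop h ?V = ?V ! h # drop (Suc h) ?V"
    using V Y by (simp_all add: Cons_nth_drop_Suc)
  ultimately show ?thesis using that[of "?V ! h"] by simp
qed

text \<open>Column insertion of the left slid column into the right one gives back the tableau. The letters of
  the left column are inserted in increasing order. When the letters below \<open>k\<close> are done, \<open>C\<close> is the finished
  lower part of the column, and the \<open>h\<close> brackets that are still open have already bumped the next \<open>h\<close>
  letters of the right column: greedy bumping serves the brackets as a queue.\<close>
lemma slide_knuth_gen:
  assumes "height h s = Some 0" "sorted_wrt (<) C" "\<forall>c\<in>set C. c < k"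
  shows "knuth_equivalent
    (rev (letters k (map slid_left s)) @ rev (drop h (letters k (map slid_right s))) @ rev C)
    (rev (letters k (map in_left s)) @ rev C @ rev (drop h (letters k (map in_right s))))"
  using assms
proof (induction s arbitrary: h k C)
  case Nil
  then show ?case by simp
next
  case (Cons x s)
  let ?X = "letters (Suc k) (map slid_left s)" and ?Y = "letters (Suc k) (map slid_right s)"
  let ?U = "letters (Suc k) (map in_left s)" and ?V = "letters (Suc k) (map in_right s)"
  have Ck: "sorted_wrt (<) (C @ [k])" "\<forall>c\<in>set (C @ [k]). c < Suc k" "\<forall>c\<in>set C. c < Suc k"
    using Cons.prems by (auto simp: sorted_wrt_append)
  \<comment> \<open>the letter \<open>k\<close> enters the column next to it; the letters above \<open>k\<close> follow by induction\<close>
  have insert_k: "knuth_equivalent (rev ?X @ k # rev Y @ y # rev C) (rev ?U @ k # rev C @ rev V @ [y])"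
    if "sorted_wrt (<) (y # Y)" "k \<le> y" "\<forall>z\<in>set Y. k < z"
      and IH: "knuth_equivalent (rev ?X @ rev Y @ rev (C @ [k])) (rev ?U @ rev (C @ [k]) @ rev V)"
    for y Y V
  proof -
    have "sorted_wrt (>) (rev Y @ y # rev C)"
      using that(1-3) Cons.prems(2,3) by (fastforce simp: sorted_wrt_append sorted_wrt_rev)
    then have "knuth_equivalent (k # rev Y @ y # rev C) (rev Y @ k # rev C @ [y])"
      using that Cons.prems(3) by (intro column_bump) auto
    from knuth_equivalent_context[OF this, of "rev ?X" "[]"]
    have "knuth_equivalent (rev ?X @ k # rev Y @ y # rev C) (rev ?X @ rev Y @ k # rev C @ [y])"
      by simp
    also have "knuth_equivalent \<dots> (rev ?U @ k # rev C @ rev V @ [y])"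
      using knuth_equivalent_context[OF IH, of "[]" "[y]"] by simp
    finally show ?thesis .
  qed
  \<comment> \<open>\<open>k\<close> bumps the \<open>h'\<close>-th letter above \<open>k\<close> in the right column if \<open>h'\<close> brackets are open after \<open>k\<close>\<close>
  have bump: ?case if "height h' s = Some 0" and "h' > 0" and
    "slid_left x" "in_left x" and
    "drop h (letters k (map slid_right (x # s))) = drop (h' - 1) ?Y"
    "drop h (letters k (map in_right (x # s))) = drop (h' - 1) ?V" for h'
  proof -
    obtain g where h': "h' = Suc g" using \<open>h' > 0\<close> by (cases h') auto
    obtain y where y: "drop g ?Y = y # drop h' ?Y" "drop g ?V = y # drop h' ?V" "Suc k \<le> y"
      using height_Suc_drop[of g s "Suc k"] \<open>height h' s = Some 0\<close> unfolding h' by blast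
    have "sorted_wrt (<) (y # drop h' ?Y)"
      using sorted_letters[of "Suc k" "map slid_right s"] sorted_wrt_drop y(1) by metis
    moreover have "\<forall>z\<in>set (drop h' ?Y). k < z"
      using letters_ge[of _ "Suc k"] set_drop_subset by fastforce
    ultimately have "knuth_equivalent (rev ?X @ k # rev (drop h' ?Y) @ y # rev C)
        (rev ?U @ k # rev C @ rev (drop h' ?V) @ [y])"
      using insert_k Cons.IH[OF that(1) Ck(1,2)] y(3) by simp
    then show ?thesis using that(3-6) y h' by simp
  qed
  show ?case
  proof (cases x)
    case Neither
    then show ?thesis using Cons.IH[of h C "Suc k"] Cons.prems Ck(3) by simp
  next
    case Close
    then show ?thesis using Cons.IH[of "h - 1" C "Suc k"] Cons.prems Ck(3)
      by (cases h) auto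
  next
    case Free
    then show ?thesis using Cons.IH[OF _ Ck(1,2), of 0] Cons.prems
      by (auto split: if_splits)
  next
    case Open
    then show ?thesis using bump[of "Suc h"] Cons.prems by simp
  next
    case Both
    show ?thesis
    proof (cases h)
      case 0
      have "knuth_equivalent (rev ?X @ rev ?Y @ rev (C @ [k])) (rev ?U @ rev (C @ [k]) @ rev ?V)"
        using Cons.IH[OF _ Ck(1,2), of 0] Cons.prems(1) Both 0 by simp
      moreover have "sorted_wrt (<) (k # ?Y)" "\<forall>z\<in>set ?Y. k < z"
        using sorted_letters[of "Suc k"] letters_ge[of _ "Suc k"] by (auto simp: Suc_le_eq)
      ultimately show ?thesis using insert_k[of k ?Y ?V] 0 Both by simp
    next
      case (Suc g)
      then show ?thesis using bump[of h] Cons.prems Both by simp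
    qed
  qed
qed

lemma slide_knuth:
  assumes "height 0 s = Some 0"
  shows "knuth_equivalent (slid_columns s) (two_columns s)"
  using slide_knuth_gen[OF assms, of "[]" 1] by (simp add: slid_columns_def two_columns_def)

section \<open>Two-column tableaux and brackets\<close>

text \<open>The condition on the rows of a two-column tableau as a recursion, which suits induction along the
  alphabet; the columns are increasing lists.\<close>
fun dominates :: "nat list \<Rightarrow> nat list \<Rightarrow> bool" where
  "dominates A [] = True"
| "dominates [] (d # D) = False"
| "dominates (a # A) (d # D) \<longleftrightarrow> a \<le> d \<and> dominates A D"

lemma dominates_iff:
  "dominates A D \<longleftrightarrow> length D \<le> length A \<and> (\<forall>i<length D. A ! i \<le> D ! i)"
  by (induction A D rule: dominates.induct) (auto simp: less_Suc_eq_0_disj)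

lemma two_column_tableau_iff:
  "two_column_tableau u v \<longleftrightarrow> column_word u \<and> column_word v \<and> dominates (rev u) (rev v)"
  by (auto simp: two_column_tableau_def dominates_iff)

text \<open>The list \<open>H\<close> holds letters of the left column that have no partner in their row yet. The \<open>Free\<close>
  letters among them are not counted by \<open>h\<close>.\<close>
lemma height_dominates:
  assumes "height h s = Some e" "h \<le> length H" "\<forall>a\<in>set H. a \<le> k"
  shows "dominates (H @ letters k (map in_left s)) (letters k (map in_right s))"
  using assms
proof (induction s arbitrary: h k H)
  case Nil
  then show ?case by simp
next
  case (Cons x s)
  have H: "\<forall>a\<in>set H. a \<le> Suc k" using Cons.prems(3) by auto
  show ?case
  proof (cases x)
    case Both
    show ?thesis
    proof (cases H)
      case Nil
      then show ?thesis using Cons.IH[of h "[]" "Suc k"] Cons.prems Both by simp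
    next
      case (Cons a H')
      then show ?thesis using Cons.IH[of h "H' @ [k]" "Suc k"] Cons.prems H Both by simp
    qed
  next
    case Close
    then obtain a H' where "H = a # H'" "h > 0" using Cons.prems by (cases H) (auto split: if_splits)
    then show ?thesis using Cons.IH[of "h - 1" H' "Suc k"] Cons.prems H Close by simp
  next
    case Neither
    then show ?thesis using Cons.IH[of h H "Suc k"] Cons.prems H by simp
  next
    case Open
    then show ?thesis using Cons.IH[of "Suc h" "H @ [k]" "Suc k"] Cons.prems H by simp
  next
    case Free
    then show ?thesis using Cons.IH[of 0 "H @ [k]" "Suc k"] Cons.prems H by (simp split: if_splits)
  qed
qed

lemma height_tableau:
  "height 0 s = Some e \<Longrightarrow>
     two_column_tableau (rev (letters k (map in_left s))) (rev (letters k (map in_right s)))"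
  using height_dominates[of 0 s e "[]" k] by (simp add: two_column_tableau_iff column_word_letters)

text \<open>The labels \<open>Open\<close> and \<open>Free\<close> depend on the letters to come, so they are found from the right. The
  zeros stand for \<open>h\<close> pending brackets of smaller letters; \<open>e\<close> of them will be closed.\<close>
lemma dominates_height:
  assumes "length us = length vs"
    and "dominates (replicate h 0 @ letters k us) (letters k vs)"
  shows "\<exists>e s. e \<le> h \<and> height e s = Some 0 \<and> map in_left s = us \<and> map in_right s = vs"
  using assms
proof (induction us vs arbitrary: h k rule: list_induct2)
  case Nil
  have "height 0 [] = Some 0" by simp
  then show ?case by fastforce
next
  case (Cons a us b vs)
  \<comment> \<open>a pending bracket is recorded as a zero in front, whatever its letter was\<close>
  have pad: "dominates (replicate (Suc h) 0 @ A) D" if "dominates (replicate h 0 @ x # A) D" for A D h x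
    using that
  proof (induction h arbitrary: D)
    case 0
    then show ?case by (cases D) auto
  next
    case (Suc h)
    then show ?case by (cases D) auto
  qed
  have prepend: ?case if "e \<le> g" "height e s = Some 0" "map in_left s = us" "map in_right s = vs"
    "step x e' = Some e" "e' \<le> h" "in_left x = a" "in_right x = b" for e g s x e'
    using that by (intro exI[of _ e'] exI[of _ "x # s"]) simp
  show ?case
  proof (cases a; cases b)
    assume ab: a b
    have "dominates (replicate h 0 @ letters (Suc k) us) (letters (Suc k) vs)"
      using Cons.prems ab pad by (cases h) auto
    from Cons.IH[OF this] show ?thesis using prepend[of _ h _ Both] ab by auto
  next
    assume ab: a "\<not> b"
    have "dominates (replicate (Suc h) 0 @ letters (Suc k) us) (letters (Suc k) vs)"
      using Cons.prems ab by (intro pad) auto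
    from Cons.IH[OF this] obtain e s where s: "e \<le> Suc h" "height e s = Some 0"
      "map in_left s = us" "map in_right s = vs" by auto
    show ?thesis
    proof (cases e)
      case 0
      then show ?thesis using prepend[OF s, of Free 0] ab by simp
    next
      case (Suc e')
      then show ?thesis using prepend[OF s, of Open e'] ab s(1) by simp
    qed
  next
    assume ab: "\<not> a" b
    have "h \<noteq> 0"
    proof
      assume "h = 0"
      then show False using Cons.prems ab letters_ge[of _ "Suc k" us]
        by (cases "letters (Suc k) us") (auto simp: Suc_le_eq dest: leD)
    qed
    then obtain g where g: "h = Suc g" by (cases h) auto
    then have "dominates (replicate g 0 @ letters (Suc k) us) (letters (Suc k) vs)"
      using Cons.prems ab by simp
    from Cons.IH[OF this] obtain e s where s: "e \<le> g" "height e s = Some 0"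
      "map in_left s = us" "map in_right s = vs" by auto
    then show ?thesis using prepend[OF s, of Close "Suc e"] ab g by simp
  next
    assume ab: "\<not> a" "\<not> b"
    have "dominates (replicate h 0 @ letters (Suc k) us) (letters (Suc k) vs)"
      using Cons.prems ab by simp
    from Cons.IH[OF this] show ?thesis using prepend[of _ h _ Neither] ab by auto
  qed
qed

text \<open>Only \<open>Open\<close> and \<open>Free\<close> can be confused, but they ask for different heights of the remaining symbols.\<close>
lemma symbols_unique:
  assumes "height h s = Some 0" "height h' s' = Some 0"
    "map in_left s = map in_left s'" "map in_right s = map in_right s'"
  shows "h = h' \<and> s = s'"
proof -
  have "length s = length s'" using assms(3) map_eq_imp_length_eq by blast
  then show ?thesis using assms
  proof (induction s s' arbitrary: h h' rule: list_induct2)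
    case Nil
    then show ?case by simp
  next
    case (Cons x s x' s')
    obtain e where e: "step x h = Some e" "height e s = Some 0"
      using Cons.prems(1) by (auto simp: bind_eq_Some_conv)
    obtain e' where e': "step x' h' = Some e'" "height e' s' = Some 0"
      using Cons.prems(2) by (auto simp: bind_eq_Some_conv)
    have "e = e'" "s = s'" using Cons.IH[OF e(2) e'(2)] Cons.prems(3,4) by auto
    then show ?case using e(1) e'(1) Cons.prems(3,4)
      by (cases x; cases x') (auto split: if_splits)
  qed
qed

section \<open>Complement and reversal of the alphabet\<close>

lemma column_word_eq:
  assumes "column_word c" "column_word d" "set c = set d"
  shows "c = d"
proof -
  have "rev c = rev d"
    using assms sorted_distinct_set_unique[of "rev c" "rev d"]
    by (simp add: column_word_rev strict_sorted_iff)
  then show ?thesis by simp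
qed

lemma mem_letters: "x \<in> set (letters k bs) \<longleftrightarrow> k \<le> x \<and> x < k + length bs \<and> bs ! (x - k)"
proof (induction bs arbitrary: k)
  case (Cons b bs)
  show ?case
  proof (cases "x \<le> k")
    case True
    then show ?thesis using Cons by auto
  next
    case False
    then have "x - k = Suc (x - Suc k)" by simp
    then show ?thesis using Cons False by auto
  qed
qed simp

lemma column_word_letters_ex:
  assumes "column_word c" "set c \<subseteq> {1..m}"
  obtains bs where "length bs = m" "c = rev (letters 1 bs)"
proof (rule that)
  let ?bs = "map (\<lambda>i. i \<in> set c) [1..<Suc m]"
  show "length ?bs = m" by simp
  have "set (letters 1 ?bs) = set c"
  proof (intro equalityI subsetI)
    fix x assume "x \<in> set c"
    then have "1 \<le> x" "x \<le> m" using assms(2) by auto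
    moreover from this have "[1..<Suc m] ! (x - 1) = x" using nth_upt[of 1 "x - 1" "Suc m"] by simp
    ultimately show "x \<in> set (letters 1 ?bs)"
      using \<open>x \<in> set c\<close> by (simp add: mem_letters del: upt_Suc)
  next
    fix x assume x: "x \<in> set (letters 1 ?bs)"
    then have "1 \<le> x" "x \<le> m" by (simp_all add: mem_letters del: upt_Suc)
    moreover from this have "[1..<Suc m] ! (x - 1) = x" using nth_upt[of 1 "x - 1" "Suc m"] by simp
    ultimately show "x \<in> set c" using x by (simp add: mem_letters del: upt_Suc)
  qed
  then show "c = rev (letters 1 ?bs)"
    using assms(1) column_word_letters by (intro column_word_eq) (auto simp del: upt_Suc)
qed

lemma column_word_star: "column_word c \<Longrightarrow> set c \<subseteq> {..2 * n} \<Longrightarrow> column_word (star n c)"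
  unfolding column_word_def star_def sorted_wrt_rev sorted_wrt_map
  by (erule sorted_wrt_mono_rel[rotated]) (auto simp: subset_iff)

lemma star_vee_letters:
  assumes "length bs = 2 * n"
  shows "star n (vee n (rev (letters 1 bs))) = rev (letters 1 (rev (map Not bs)))"
proof (rule column_word_eq)
  have vee: "set (vee n (rev (letters 1 bs))) = {x \<in> {1..2 * n}. \<not> bs ! (x - 1)}"
    using assms by (auto simp: vee_def mem_letters)
  have "column_word (vee n c)" for c
    by (simp add: vee_def column_word_rev strict_sorted_list_of_set)
  then show "column_word (star n (vee n (rev (letters 1 bs))))"
    using vee by (intro column_word_star) (auto simp del: One_nat_def)
  have "set (star n (vee n (rev (letters 1 bs)))) =
      (\<lambda>i. 2 * n + 1 - i) ` {x \<in> {1..2 * n}. \<not> bs ! (x - 1)}"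
    by (simp add: star_def vee del: One_nat_def)
  also have "\<dots> = {x \<in> {1..2 * n}. \<not> bs ! (2 * n - x)}"
  proof (intro equalityI subsetI)
    fix x assume "x \<in> {x \<in> {1..2 * n}. \<not> bs ! (2 * n - x)}"
    then show "x \<in> (\<lambda>i. 2 * n + 1 - i) ` {x \<in> {1..2 * n}. \<not> bs ! (x - 1)}"
      by (intro image_eqI[of _ _ "2 * n + 1 - x"]) auto
  qed auto
  also have "\<dots> = set (rev (letters 1 (rev (map Not bs))))"
    using assms by (auto simp: mem_letters rev_nth)
  finally show "set (star n (vee n (rev (letters 1 bs)))) = set (rev (letters 1 (rev (map Not bs))))" .
qed (simp add: column_word_letters)

text \<open>Taking complements exchanges the letters in both columns with those in neither, and the letters
  only in the left column with those only in the right one. The alphabet is read backwards afterwards,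
  so matched brackets stay matched. A \<open>Free\<close> letter ends up only in the right column, which is where
  sliding moves it; hence it counts as \<open>Free\<close> again.\<close>
fun flip :: "symbol \<Rightarrow> symbol" where
  "flip Both = Neither"
| "flip Neither = Both"
| "flip Open = Close"
| "flip Close = Open"
| "flip Free = Free"

lemma flip_flip [simp]: "flip (flip x) = x"
  by (cases x) auto

definition mirror :: "symbol list \<Rightarrow> symbol list" where
  "mirror s = rev (map flip s)"

lemma mirror_simps [simp]:
  "mirror [] = []" "mirror (x # s) = mirror s @ [flip x]" "mirror (s @ t) = mirror t @ mirror s"
  "mirror (mirror s) = s" "length (mirror s) = length s"
  by (simp_all add: mirror_def rev_map comp_def)

lemma slid_flip: "slid_left (flip x) = (\<not> in_left x)" "slid_right (flip x) = (\<not> in_right x)"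
  by (cases x; simp)+

text \<open>On symbols, \<open>\<or>*\<close> becomes \<open>mirror\<close>, with the \<open>Free\<close> letters slid to the
  right column.\<close>
lemma star_vee_two_columns:
  assumes "length s = 2 * n"
  shows "star n (vee n (rev (letters 1 (map in_left s)))) @ star n (vee n (rev (letters 1 (map in_right s))))
    = slid_columns (mirror s)"
  using assms star_vee_letters[of "map in_left s" n] star_vee_letters[of "map in_right s" n]
  by (simp add: slid_columns_def mirror_def rev_map comp_def slid_flip)

lemma height_mirror: "height h s = Some e \<Longrightarrow> height e (mirror s) = Some h"
proof (induction s arbitrary: h)
  case (Cons x s)
  then show ?case
    by (cases x) (auto simp: height_append split: if_splits)
qed simp

text \<open>Opening and closing brackets balance, so the difference of the column heights counts the \<open>Free\<close>
  letters and the change of height.\<close>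
lemma height_length:
  "height h s = Some e \<Longrightarrow>
    length (letters k (map in_right s)) + count_list s Free + e = length (letters k (map in_left s)) + h"
proof (induction s arbitrary: h k)
  case (Cons x s)
  obtain g where g: "step x h = Some g" "height g s = Some e"
    using Cons.prems by (auto simp: bind_eq_Some_conv)
  show ?case using Cons.IH[OF g(2), of "Suc k"] g(1) by (cases x) (auto split: if_splits)
qed simp

lemma count_list_mirror: "count_list (mirror s) Free = count_list s Free"
proof (induction s)
  case (Cons x s)
  then show ?case by (cases x) auto
qed simp

section \<open>Type A operators on two columns\<close>

lemma string_length_eqI:
  assumes "\<And>b. Q b \<Longrightarrow> (g b = None \<longleftrightarrow> m b = 0)"
    and "\<And>b b'. Q b \<Longrightarrow> g b = Some b' \<Longrightarrow> Q b' \<and> m b = Suc (m b')"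
    and "Q b"
  shows "string_length g b = m b"
proof -
  \<comment> \<open>iteration lowers \<open>m\<close> by one per step and stops exactly at \<open>m = 0\<close>\<close>
  have iter: "(iterate g k b = None \<longleftrightarrow> m b < k) \<and>
    (\<forall>b'. iterate g k b = Some b' \<longrightarrow> Q b' \<and> m b = m b' + k)" for k
  proof (induction k)
    case 0
    then show ?case using assms(3) by (simp add: iterate_def)
  next
    case (Suc k)
    show ?case
    proof (cases "iterate g k b")
      case None
      then show ?thesis using Suc by (simp add: iterate_Suc)
    next
      case (Some c)
      then have "Q c" "m b = m c + k" using Suc by auto
      then show ?thesis using Some assms(1)[of c] assms(2)[of c]
        by (cases "g c") (auto simp: iterate_Suc)
    qed
  qed
  show ?thesis
    unfolding string_length_def by (rule Greatest_equality) (use iter in \<open>auto simp: not_less[symmetric]\<close>)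
qed

lemma string_length_e_letter: "string_length (e_letter i) x = (if x = Suc i then 1 else 0)"
  by (rule string_length_eqI[where Q = "\<lambda>_. True" and m = "\<lambda>x. if x = Suc i then 1 else 0"])
    (auto simp: e_letter_def split: if_splits)

text \<open>The value \<open>\<phi>\<^sub>i\<close> of a word: \<open>i\<close> contributes one, and \<open>i + 1\<close> cancels one contribution to its right.\<close>
primrec phi :: "nat \<Rightarrow> word \<Rightarrow> nat" where
  "phi i [] = 0"
| "phi i (x # w) = (if x = i then Suc (phi i w) else if x = Suc i then phi i w - 1 else phi i w)"

lemma string_length_fA: "string_length (fA i) w = phi i w"
proof -
  have "(fA i w = None \<longleftrightarrow> phi i w = 0) \<and> (\<forall>w'. fA i w = Some w' \<longrightarrow> phi i w = Suc (phi i w'))"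
    if "length w = m" for m w
    using that
  proof (induction m arbitrary: w)
    case 0
    then show ?case by (simp add: fA_Nil)
  next
    case (Suc m)
    then obtain x v where w: "w = x # v" "length v = m" by (cases w) auto
    have v: "string_length (fA i) v = phi i v"
      by (rule string_length_eqI[where Q = "\<lambda>v. length v = m"])
        (use Suc.IH fA_length w(2) in auto)
    have "fA i v = None \<longleftrightarrow> phi i v = 0" "\<And>v'. fA i v = Some v' \<Longrightarrow> phi i v = Suc (phi i v')"
      using Suc.IH[OF w(2)] by auto
    then show ?case
      by (cases "fA i v") (auto simp: w(1) fA_Cons v string_length_e_letter f_letter_def)
  qed
  then have "string_length (fA i) w = phi i w" if "length w = m" for m
    by (intro string_length_eqI[where Q = "\<lambda>v. length v = m"]) (use that fA_length in auto)
  then show ?thesis by simp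
qed

lemma fA_Cons_phi:
  "fA i (x # w) = (if phi i w \<le> (if x = Suc i then 1 else 0)
     then if x = i then Some (Suc i # w) else None
     else map_option ((#) x) (fA i w))"
  by (simp add: fA_Cons string_length_fA string_length_e_letter f_letter_def)

lemma eA_Cons_phi:
  "eA i (x # w) = (if x = Suc i \<and> phi i w = 0 then Some (i # w) else map_option ((#) x) (eA i w))"
  by (auto simp: string_length_fA string_length_e_letter e_letter_def)

lemma phi_skip: "i \<notin> set p \<Longrightarrow> Suc i \<notin> set p \<Longrightarrow> phi i (p @ w) = phi i w"
  by (induction p) auto

lemma fA_phi_0: "phi i w = 0 \<Longrightarrow> fA i w = None"
  by (induction w) (auto simp: fA_Nil fA_Cons_phi split: if_splits)

lemma fA_skip: "i \<notin> set p \<Longrightarrow> Suc i \<notin> set p \<Longrightarrow> fA i (p @ w) = map_option ((@) p) (fA i w)"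
proof (induction p)
  case Nil
  then show ?case by (cases "fA i w") auto
next
  case (Cons x p)
  then show ?case using fA_phi_0[of i w]
    by (cases "fA i w") (auto simp: fA_Cons_phi phi_skip)
qed

lemma eA_skip: "i \<notin> set p \<Longrightarrow> Suc i \<notin> set p \<Longrightarrow> eA i (p @ w) = map_option ((@) p) (eA i w)"
proof (induction p)
  case Nil
  then show ?case by (cases "eA i w") auto
next
  case (Cons x p)
  then show ?case by (cases "eA i w") (auto simp: eA_Cons_phi simp del: eA.simps(2))
qed

text \<open>The operators \<open>f\<^sub>i\<close> and \<open>e\<^sub>i\<close> of type \<open>A\<close> on the symbols of the letters \<open>i\<close> and \<open>i + 1\<close>. They
  exchange the two symbols, except along the string
  \<open>Both Neither \<mapsto> Open Close \<mapsto> Neither Both\<close> of \<open>f\<^sub>i\<close>, where \<open>Free Close\<close> is treated like \<open>Open Close\<close>.\<close>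
definition f_pair :: "symbol \<Rightarrow> symbol \<Rightarrow> (symbol \<times> symbol) option" where
  "f_pair x y =
     (if x = Both \<and> y = Neither then Some (Open, Close)
      else if x \<in> {Open, Free} \<and> y = Close then Some (Neither, Both)
      else if x \<noteq> y \<and> (x = Both \<or> y = Neither) then Some (y, x)
      else None)"

definition e_pair :: "symbol \<Rightarrow> symbol \<Rightarrow> (symbol \<times> symbol) option" where
  "e_pair x y =
     (if x = Neither \<and> y = Both then Some (Open, Close)
      else if x \<in> {Open, Free} \<and> y = Close then Some (Both, Neither)
      else if x \<noteq> y \<and> (x = Neither \<or> y = Both) then Some (y, x)
      else None)"

text \<open>All other letters form three blocks \<open>A\<close>, \<open>B\<close>, \<open>C\<close> on which the operators for \<open>i\<close> do not act, so the
  operators can be evaluated on the at most four letters in between.\<close>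
lemma two_columns_local:
  obtains A B C where
    "\<And>x y. two_columns (p @ [x, y] @ q) =
       A @ rev (letters (Suc (length p)) (map in_left [x, y])) @
       B @ rev (letters (Suc (length p)) (map in_right [x, y])) @ C"
    and "Suc (length p) \<notin> set (A @ B @ C)" and "Suc (Suc (length p)) \<notin> set (A @ B @ C)"
proof -
  let ?k = "Suc (Suc (Suc (length p)))"
  have "j \<notin> set (letters 1 (map g p))" "j \<notin> set (letters ?k (map g q))"
    if "j = Suc (length p) \<or> j = Suc (Suc (length p))" for j g
    using that letters_ge[of j ?k "map g q"] letters_lt[of j 1 "map g p"] by auto
  then show ?thesis
    by (intro that[of "rev (letters ?k (map in_left q))"
        "rev (letters 1 (map in_left p)) @ rev (letters ?k (map in_right q))"
        "rev (letters 1 (map in_right p))"])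
      (simp_all add: two_columns_def letters_append)
qed

lemma fA_two_columns:
  "fA (Suc (length p)) (two_columns (p @ [x, y] @ q)) =
     map_option (\<lambda>(x', y'). two_columns (p @ [x', y'] @ q)) (f_pair x y)"
proof -
  obtain A B C where W: "\<And>x y. two_columns (p @ [x, y] @ q) =
       A @ rev (letters (Suc (length p)) (map in_left [x, y])) @
       B @ rev (letters (Suc (length p)) (map in_right [x, y])) @ C"
    and "Suc (length p) \<notin> set (A @ B @ C)" "Suc (Suc (length p)) \<notin> set (A @ B @ C)"
    using two_columns_local[of p q] by blast
  moreover from this have "phi (Suc (length p)) C = 0" "fA (Suc (length p)) C = None"
    using phi_skip[of "Suc (length p)" C "[]"] by (simp_all add: fA_phi_0)
  ultimately show ?thesis
    unfolding W by (cases x; cases y) (simp_all add: f_pair_def W fA_Cons_phi fA_skip phi_skip)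
qed

lemma eA_two_columns:
  "eA (Suc (length p)) (two_columns (p @ [x, y] @ q)) =
     map_option (\<lambda>(x', y'). two_columns (p @ [x', y'] @ q)) (e_pair x y)"
proof -
  obtain A B C where W: "\<And>x y. two_columns (p @ [x, y] @ q) =
       A @ rev (letters (Suc (length p)) (map in_left [x, y])) @
       B @ rev (letters (Suc (length p)) (map in_right [x, y])) @ C"
    and "Suc (length p) \<notin> set (A @ B @ C)" "Suc (Suc (length p)) \<notin> set (A @ B @ C)"
    using two_columns_local[of p q] by blast
  moreover from this have "phi (Suc (length p)) C = 0" "eA (Suc (length p)) C = None"
    using phi_skip[of "Suc (length p)" C "[]"] eA_skip[of "Suc (length p)" C "[]"] by simp_all
  ultimately show ?thesis
    unfolding W
    by (cases x; cases y) (simp_all add: e_pair_def W eA_Cons_phi eA_skip phi_skip del: eA.simps(2))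
qed

section \<open>The virtual crystal\<close>

text \<open>A tableau fixed by \<open>mirror\<close> whose brackets do not cross the middle of the alphabet is determined by
  its symbols for the letters up to \<open>n\<close>.\<close>
definition virtual_word :: "symbol list \<Rightarrow> word" where
  "virtual_word t = two_columns (t @ mirror t)"

definition virtual_seq :: "nat \<Rightarrow> nat \<Rightarrow> symbol list \<Rightarrow> bool" where
  "virtual_seq n r t \<longleftrightarrow> length t = n \<and> count_list t Free = n - r \<and> height 0 t = Some 0"

text \<open>The two factors of a virtual operator act at mirror images of each other. The excluded pair of
  symbols never occurs in a correctly bracketed sequence.\<close>
lemma f_pair_flip:
  "f_pair x y = Some (x', y') \<Longrightarrow>
     f_pair (flip y) (flip x) = (if (x, y) = (Free, Close) then None else Some (flip y', flip x'))"
  by (cases x; cases y) (auto simp: f_pair_def)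

lemma e_pair_flip:
  "e_pair x y = Some (x', y') \<Longrightarrow>
     e_pair (flip y) (flip x) = (if (x, y) = (Free, Close) then None else Some (flip y', flip x'))"
  by (cases x; cases y) (auto simp: e_pair_def)

text \<open>Stated for either family \<open>g\<close> of type \<open>A\<close> operators: the first factor acts on the left half of the
  alphabet, the second one does the same to its mirror image.\<close>
lemma bind_two_columns:
  assumes local: "\<And>p x y q. g (Suc (length p)) (two_columns (p @ [x, y] @ q)) =
      map_option (\<lambda>(x', y'). two_columns (p @ [x', y'] @ q)) (pair x y)"
    and flip: "\<And>x y x' y'. pair x y = Some (x', y') \<Longrightarrow>
      pair (flip y) (flip x) = (if (x, y) = (Free, Close) then None else Some (flip y', flip x'))"
    and n: "length (p @ [x, y] @ q) = n"
  shows "Option.bind (g (Suc (length p)) (virtual_word (p @ [x, y] @ q))) (g (2 * n - Suc (length p))) =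
     (if (x, y) = (Free, Close) then None
      else map_option (\<lambda>(x', y'). virtual_word (p @ [x', y'] @ q)) (pair x y))"
proof (cases "pair x y")
  case None
  then show ?thesis
    using local[of p x y "q @ mirror (p @ [x, y] @ q)"] by (simp add: virtual_word_def)
next
  case (Some z)
  then obtain x' y' where xy: "pair x y = Some (x', y')" by (cases z) auto
  let ?p = "p @ [x', y'] @ q @ mirror q"
  have "g (Suc (length p)) (virtual_word (p @ [x, y] @ q)) =
      Some (two_columns (?p @ [flip y, flip x] @ mirror p))"
    using local[of p x y "q @ mirror (p @ [x, y] @ q)"] xy by (simp add: virtual_word_def)
  moreover have "2 * n - Suc (length p) = Suc (length ?p)" using n by simp
  ultimately show ?thesis
    using local[of ?p "flip y" "flip x" "mirror p"] flip[OF xy] xy by (simp add: virtual_word_def)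
qed

lemma fC_virtual_word:
  assumes "length (p @ [x, y] @ q) = n"
  shows "fC n (Suc (length p)) (virtual_word (p @ [x, y] @ q)) =
     (if (x, y) = (Free, Close) then None
      else map_option (\<lambda>(x', y'). virtual_word (p @ [x', y'] @ q)) (f_pair x y))"
proof -
  have "Suc (length p) < n" using assms by simp
  then show ?thesis
    unfolding fC_def using bind_two_columns[OF fA_two_columns f_pair_flip assms] by simp
qed

lemma eC_virtual_word:
  assumes "length (p @ [x, y] @ q) = n"
  shows "eC n (Suc (length p)) (virtual_word (p @ [x, y] @ q)) =
     (if (x, y) = (Free, Close) then None
      else map_option (\<lambda>(x', y'). virtual_word (p @ [x', y'] @ q)) (e_pair x y))"
proof -
  have "Suc (length p) < n" using assms by simp
  then show ?thesis
    unfolding eC_def using bind_two_columns[OF eA_two_columns e_pair_flip assms] by simp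
qed

lemma fC_virtual_word_last:
  "fC (Suc (length p)) (Suc (length p)) (virtual_word (p @ [x])) =
     (if x = Both then Some (virtual_word (p @ [Neither])) else None)"
proof -
  have "fA (Suc (length p)) (two_columns (p @ [a, b] @ mirror p)) =
      map_option (\<lambda>(x', y'). two_columns (p @ [x', y'] @ mirror p)) (f_pair a b)" for a b
    by (rule fA_two_columns)
  then show ?thesis
    by (cases x) (simp_all add: fC_def virtual_word_def f_pair_def)
qed

lemma eC_virtual_word_last:
  "eC (Suc (length p)) (Suc (length p)) (virtual_word (p @ [x])) =
     (if x = Neither then Some (virtual_word (p @ [Both])) else None)"
proof -
  have "eA (Suc (length p)) (two_columns (p @ [a, b] @ mirror p)) =
      map_option (\<lambda>(x', y'). two_columns (p @ [x', y'] @ mirror p)) (e_pair a b)" for a b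
    by (rule eA_two_columns)
  then show ?thesis
    by (cases x) (simp_all add: eC_def virtual_word_def e_pair_def)
qed

lemma virtual_seq_pair:
  assumes "f_pair x y = Some (x', y') \<or> e_pair x y = Some (x', y')" and "(x, y) \<noteq> (Free, Close)"
    and "virtual_seq n r (p @ [x, y] @ q)"
  shows "virtual_seq n r (p @ [x', y'] @ q)"
proof -
  have "height h [x', y'] = height h [x, y]" for h
    using assms(1,2) by (cases x; cases y) (auto simp: f_pair_def e_pair_def)
  then have "height 0 (p @ [x', y'] @ q) = height 0 (p @ [x, y] @ q)"
    unfolding height_append by simp
  moreover have "count_list (p @ [x', y'] @ q) Free = count_list (p @ [x, y] @ q) Free"
    using assms(1,2) by (cases x; cases y) (auto simp: f_pair_def e_pair_def)
  moreover have "length (p @ [x', y'] @ q) = length (p @ [x, y] @ q)" by simp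
  ultimately show ?thesis using assms(3) by (simp only: virtual_seq_def)
qed

lemma virtual_seq_last:
  "virtual_seq n r (p @ [Both]) \<longleftrightarrow> virtual_seq n r (p @ [Neither])"
  by (simp add: virtual_seq_def height_append)

text \<open>Symbols at \<open>i\<close> and \<open>i + 1\<close> change without changing the height after them or the number of \<open>Free\<close>
  letters; the last operator exchanges \<open>Both\<close> and \<open>Neither\<close> at the letter \<open>n\<close>.\<close>
lemma virtual_word_closed:
  assumes t: "virtual_seq n r t" and i: "i \<in> {1..n}"
    and w: "fC n i (virtual_word t) = Some w \<or> eC n i (virtual_word t) = Some w"
  shows "\<exists>t'. virtual_seq n r t' \<and> w = virtual_word t'"
proof (cases "i < n")
  case True
  have len: "length t = n" using t by (simp add: virtual_seq_def)
  obtain p x y q where tp: "t = p @ [x, y] @ q" and ip: "i = Suc (length p)"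
  proof
    have "drop (i - 1) t = t ! (i - 1) # t ! i # drop (Suc i) t"
      using True i len Cons_nth_drop_Suc[of "i - 1" t] Cons_nth_drop_Suc[of i t] by simp
    then show "t = take (i - 1) t @ [t ! (i - 1), t ! i] @ drop (Suc i) t"
      using append_take_drop_id[of "i - 1" t] by simp
    show "i = Suc (length (take (i - 1) t))" using True i len by simp
  qed
  have n: "length (p @ [x, y] @ q) = n" using len tp by simp
  have closed: ?thesis
    if w: "(if (x, y) = (Free, Close) then None
        else map_option (\<lambda>(x', y'). virtual_word (p @ [x', y'] @ q)) z) = Some w"
      and z: "f_pair x y = z \<or> e_pair x y = z" for z
  proof -
    have xy: "(x, y) \<noteq> (Free, Close)" using w by (rule contrapos_pn) simp
    obtain x' y' where xy': "z = Some (x', y')"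
      using w by (cases z) (auto split: if_splits)
    then have "w = virtual_word (p @ [x', y'] @ q)" using w unfolding if_not_P[OF xy] by simp
    moreover have "virtual_seq n r (p @ [x', y'] @ q)"
      using virtual_seq_pair[OF _ xy] z t unfolding xy' tp by blast
    ultimately show ?thesis by blast
  qed
  show ?thesis
    using w closed[OF _ disjI1[OF refl]] closed[OF _ disjI2[OF refl]]
    unfolding tp ip fC_virtual_word[OF n] eC_virtual_word[OF n] by blast
next
  case False
  then have i: "i = n" "0 < n" using i by simp_all
  have len: "length t = n" using t by (simp add: virtual_seq_def)
  then obtain p x where tp: "t = p @ [x]" using i(2) by (cases t rule: rev_cases) simp_all
  then have n: "n = Suc (length p)" using len by simp
  show ?thesis
  proof (cases "x = Both \<or> x = Neither")
    case True
    then have "virtual_seq n r (p @ [Both])" "virtual_seq n r (p @ [Neither])"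
      using t virtual_seq_last[of n r p] unfolding tp by auto
    moreover have "w = virtual_word (p @ [Neither]) \<or> w = virtual_word (p @ [Both])"
      using w fC_virtual_word_last[of p x] eC_virtual_word_last[of p x]
      unfolding i(1) tp n by (auto split: if_splits)
    ultimately show ?thesis by blast
  next
    case False
    then show ?thesis
      using w fC_virtual_word_last[of p x] eC_virtual_word_last[of p x]
      unfolding i(1) tp n by simp
  qed
qed

lemma letters_replicate:
  "letters k (replicate m True) = [k..<k + m]" "letters k (replicate m False) = []"
  by (induction m arbitrary: k) (simp_all add: upt_conv_Cons del: upt_Suc)

lemma mirror_replicate: "mirror (replicate m x) = replicate m (flip x)"
  by (simp add: mirror_def)

lemma virtual_word_yamanouchi:
  assumes "r \<le> n"
  shows "virtual_word (replicate r Both @ replicate (n - r) Free) = yamanouchi n r"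
proof -
  let ?t = "replicate r Both @ replicate (n - r) Free"
  have t: "?t @ mirror ?t =
      replicate r Both @ replicate (n - r) Free @ replicate (n - r) Free @ replicate r Neither"
    by (simp add: mirror_replicate)
  have "map in_left (?t @ mirror ?t) = replicate (2 * n - r) True @ replicate r False"
    "map in_right (?t @ mirror ?t) = replicate r True @ replicate (2 * n - r) False"
    unfolding t using assms by (simp_all add: replicate_add[symmetric])
  then show ?thesis
    unfolding virtual_word_def two_columns_def yamanouchi_def
    by (simp only: letters_append letters_replicate append_Nil2 add.commute[of 1])
qed

lemma last_mismatch:
  assumes "x \<in> set s" "\<not> (\<exists>p. s = p @ [x])"
  obtains p y q where "s = p @ [x, y] @ q" "y \<noteq> x"
proof -
  obtain p q where s: "s = p @ x # q" "x \<notin> set q" using split_list_last[OF assms(1)] by blast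
  with assms(2) that show ?thesis by (cases q) auto
qed

lemma first_mismatch:
  assumes "x \<in> set s" "s = [] \<or> hd s \<noteq> x"
  obtains p y q where "s = p @ [y, x] @ q" "y \<noteq> x" "x \<notin> set p"
proof -
  obtain p q where s: "s = p @ x # q" "x \<notin> set p" using split_list_first[OF assms(1)] by blast
  with assms(2) that show ?thesis by (cases p rule: rev_cases) auto
qed

lemma height_no_Close:
  "height h s = Some 0 \<Longrightarrow> set s \<subseteq> {Open, Free} \<Longrightarrow> h = 0 \<and> s = replicate (length s) Free"
proof (induction s arbitrary: h)
  case (Cons x s)
  obtain g where g: "step x h = Some g" "height g s = Some 0"
    using Cons.prems by (auto simp: bind_eq_Some_conv)
  show ?case using Cons.IH[OF g(2)] Cons.prems(2) g(1) by (auto split: if_splits)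
qed simp

text \<open>Unless \<open>t\<close> is the highest weight sequence, it is a value of some virtual \<open>f\<^sub>i\<close>. The last
  \<open>Neither\<close> comes from \<open>Both\<close> if it is at the end of \<open>t\<close>; otherwise it and the next symbol come from the
  exchanged pair, or from \<open>Open Close\<close> if the next symbol is \<open>Both\<close>. Without \<open>Neither\<close>, a \<open>Both\<close> preceded
  by another symbol can be exchanged with it. If there is none of these, then the first \<open>Close\<close>
  directly follows an \<open>Open\<close>, and this pair comes from \<open>Both Neither\<close>. Without \<open>Close\<close> there is no \<open>Open\<close>.\<close>
lemma virtual_seq_raise:
  assumes t: "virtual_seq n r t" and ne: "t \<noteq> replicate r Both @ replicate (n - r) Free" and "r \<le> n"
  shows "(\<exists>p. t = p @ [Neither]) \<or>
    (\<exists>p x y q x' y'. t = p @ [x, y] @ q \<and> f_pair x' y' = Some (x, y) \<and>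
       virtual_seq n r (p @ [x', y'] @ q) \<and> (x', y') \<noteq> (Free, Close))"
proof -
  have raise: ?thesis
    if "t = p @ [x, y] @ q" "e_pair x y = Some (x', y')" "f_pair x' y' = Some (x, y)"
      "(x, y) \<noteq> (Free, Close)" "(x', y') \<noteq> (Free, Close)" for p x y q x' y'
    using that t virtual_seq_pair[of x y x' y' n r p q] by blast
  consider (neither) "Neither \<in> set t" | (both) u where "Neither \<notin> set t"
      "t = takeWhile (\<lambda>x. x = Both) t @ u" "u = dropWhile (\<lambda>x. x = Both) t" "Both \<in> set u"
    | (rest) u where "Neither \<notin> set t" "t = takeWhile (\<lambda>x. x = Both) t @ u" "Both \<notin> set u"
    by (metis takeWhile_dropWhile_id)
  then show ?thesis
  proof cases
    case neither
    show ?thesis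
    proof (cases "\<exists>p. t = p @ [Neither]")
      case False
      then obtain p y q where y: "t = p @ [Neither, y] @ q" "y \<noteq> Neither"
        using last_mismatch[OF neither] by metis
      show ?thesis
        using raise[OF y(1), of "if y = Both then Open else y" "if y = Both then Close else Neither"] y(2)
        by (cases y) (auto simp: e_pair_def f_pair_def)
    qed simp
  next
    case both
    have "u = [] \<or> hd u \<noteq> Both" using hd_dropWhile[of "\<lambda>x. x = Both" t] both(3) by auto
    then obtain p y q where y: "u = p @ [y, Both] @ q" "y \<noteq> Both"
      using first_mismatch[OF both(4)] by metis
    have ty: "t = (takeWhile (\<lambda>x. x = Both) t @ p) @ [y, Both] @ q"
      using both(2) unfolding y(1) by simp
    then have "y \<in> set t" by (metis in_set_conv_decomp append_Cons)
    then have "y \<noteq> Neither" using both(1) by auto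
    then show ?thesis
      using raise[OF ty, of Both y] y(2) by (cases y) (auto simp: e_pair_def f_pair_def)
  next
    case rest
    have Both: "takeWhile (\<lambda>x. x = Both) t = replicate m Both"
      if "m = length (takeWhile (\<lambda>x. x = Both) t)" for m
      using that by (auto intro!: replicate_eqI dest: set_takeWhileD)
    obtain m where tu: "t = replicate m Both @ u" using rest(2) Both by metis
    have "height h (replicate m Both @ u) = height h u" for h by (induction m) auto
    then have hu: "height 0 u = Some 0" using t by (simp add: virtual_seq_def tu)
    have u: "set u \<subseteq> {Open, Close, Free}"
    proof
      fix z assume "z \<in> set u"
      then show "z \<in> {Open, Close, Free}" using rest(1,3) unfolding tu by (cases z rule: symbol.exhaust) auto
    qed
    show ?thesis
    proof (cases "Close \<in> set u")
      case True
      have "u = [] \<or> hd u \<noteq> Close" using hu by (cases u) auto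
      then obtain p y q where y: "u = p @ [y, Close] @ q" "y \<noteq> Close"
        using first_mismatch[OF True] by metis
      have "y \<noteq> Free"
        using hu unfolding y(1) by (auto simp: height_append bind_eq_Some_conv split: if_splits)
      then have "y = Open" using u y by auto
      then show ?thesis
        using raise[of "replicate m Both @ p" Open Close q Both Neither] y(1) tu
        by (simp add: e_pair_def f_pair_def)
    next
      case False
      then obtain a where "u = replicate a Free" using height_no_Close[OF hu] u by blast
      then have tm: "t = replicate m Both @ replicate a Free" using tu by simp
      have "count_list (replicate b x) y = (if x = y then b else 0)" for b and x y :: symbol
        by (induction b) auto
      then have "a = n - r" "m + a = n" using t unfolding virtual_seq_def tm by simp_all
      then show ?thesis using ne tm assms(3) by auto
    qed
  qed
qed

lemma fA_sum_list: "fA i w = Some w' \<Longrightarrow> sum_list w' = Suc (sum_list w)"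
  by (induction w arbitrary: w') (auto simp: fA_Nil fA_Cons_phi split: if_splits)

lemma fC_sum_list: "fC n i w = Some w' \<Longrightarrow> sum_list w < sum_list w'"
  by (auto simp: fC_def bind_eq_Some_conv dest!: fA_sum_list split: if_splits)

text \<open>Going back along virtual operators \<open>f\<^sub>i\<close> lowers the sum of the letters, so it ends at the highest
  weight tableau.\<close>
lemma virtual_word_in_virtual_crystal:
  assumes "virtual_seq n r t" "r \<le> n"
  shows "virtual_word t \<in> virtual_crystal n r"
  using assms(1)
proof (induction "sum_list (virtual_word t)" arbitrary: t rule: less_induct)
  case less
  have lower: ?case if "virtual_seq n r t'" "i \<in> {1..n}" "fC n i (virtual_word t') = Some (virtual_word t)" for t' i
    using less.hyps[OF fC_sum_list[OF that(3)] that(1)] that(2,3) by (rule virtual_crystal.intros(3))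
  show ?case
  proof (cases "t = replicate r Both @ replicate (n - r) Free")
    case True
    then show ?thesis
      using virtual_word_yamanouchi[OF assms(2)] by (simp add: virtual_crystal.intros(1))
  next
    case False
    have len: "length t = n" using less.prems by (simp add: virtual_seq_def)
    from virtual_seq_raise[OF less.prems False assms(2)] show ?thesis
    proof (elim disjE exE conjE)
      fix p assume t: "t = p @ [Neither]"
      then show ?thesis
        using lower[of "p @ [Both]" n] virtual_seq_last[of n r p] less.prems fC_virtual_word_last[of p Both] len
        by auto
    next
      fix p x y q x' y'
      assume *: "t = p @ [x, y] @ q" "f_pair x' y' = Some (x, y)" "virtual_seq n r (p @ [x', y'] @ q)"
        "(x', y') \<noteq> (Free, Close)"
      then show ?thesis
        using lower[of "p @ [x', y'] @ q" "Suc (length p)"] fC_virtual_word[of p x' y' q n] len by auto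
    qed
  qed
qed

lemma virtual_crystal_eq:
  assumes "r \<le> n"
  shows "virtual_crystal n r = virtual_word ` Collect (virtual_seq n r)"
proof (intro equalityI subsetI)
  fix w assume "w \<in> virtual_crystal n r"
  then show "w \<in> virtual_word ` Collect (virtual_seq n r)"
  proof induction
    case 1
    have "height 0 (replicate a Both) = Some 0" "height 0 (replicate a Free) = Some 0" for a
      by (induction a) auto
    moreover have "count_list (replicate a x) y = (if x = y then a else 0)" for a and x y :: symbol
      by (induction a) auto
    ultimately have "virtual_seq n r (replicate r Both @ replicate (n - r) Free)"
      using assms by (simp add: virtual_seq_def height_append)
    then show ?case using virtual_word_yamanouchi[OF assms] by (metis image_eqI mem_Collect_eq)
  next
    case (2 w i w')
    then show ?case using virtual_word_closed[of n r _ i w'] by auto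
  next
    case (3 w i w')
    then show ?case using virtual_word_closed[of n r _ i w'] by auto
  qed
qed (use virtual_word_in_virtual_crystal assms in auto)

section \<open>The characterization\<close>

lemma length_letters: "length (letters k (map g s)) = length (filter g s)"
  by (induction s arbitrary: k) auto

lemma length_slid_mirror:
  "length (letters k (map slid_left (mirror s))) + length (letters j (map in_left s)) = length s"
  "length (letters k (map slid_right (mirror s))) + length (letters j (map in_right s)) = length s"
proof -
  have "length (letters k (map g (mirror s))) = length (filter (\<lambda>x. g (flip x)) s)" for g
    by (simp add: length_letters mirror_def rev_filter[symmetric] filter_map comp_def)
  then show "length (letters k (map slid_left (mirror s))) + length (letters j (map in_left s)) = length s"
    "length (letters k (map slid_right (mirror s))) + length (letters j (map in_right s)) = length s"
    using sum_length_filter_compl[of in_left s] sum_length_filter_compl[of in_right s]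
    by (simp_all add: length_letters slid_flip)
qed

lemma two_columns_inject:
  assumes "height 0 s = Some 0" "height 0 s' = Some 0" "length s = length s'"
    and "count_list s Free = count_list s' Free" and eq: "two_columns s = two_columns s'"
  shows "s = s'"
proof -
  have "length (two_columns s) = length (two_columns s')" by (simp add: eq)
  then have "length (letters 1 (map in_left s)) = length (letters 1 (map in_left s'))"
    using height_length[OF assms(1), of 1] height_length[OF assms(2), of 1] assms(4)
    by (simp add: two_columns_def)
  then have "letters 1 (map in_left s) = letters 1 (map in_left s')"
    "letters 1 (map in_right s) = letters 1 (map in_right s')"
    using eq by (simp_all add: two_columns_def)
  then have "map in_left s = map in_left s'" "map in_right s = map in_right s'"
    using assms(3) by (simp_all add: letters_inject)
  then show ?thesis using symbols_unique[OF assms(1,2)] by simp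
qed

lemma subword_letters:
  assumes "length t = n" "length d = n"
  shows "subword {1..n} (rev (letters 1 (map g (t @ d)))) = rev (letters 1 (map g t))"
    and "subword {n + 1..2 * n} (rev (letters 1 (map g (t @ d)))) = rev (letters (n + 1) (map g d))"
proof -
  let ?T = "letters 1 (map g t)" and ?D = "letters (n + 1) (map g d)"
  have "letters 1 (map g (t @ d)) = ?T @ ?D" using assms by (simp add: letters_append)
  moreover have T: "1 \<le> x \<and> x \<le> n" if "x \<in> set ?T" for x
    using that letters_ge letters_lt[of x 1 "map g t"] assms by fastforce
  moreover have D: "n + 1 \<le> x \<and> x \<le> 2 * n" if "x \<in> set ?D" for x
    using that letters_ge letters_lt[of x "n + 1" "map g d"] assms by fastforce
  have "filter (\<lambda>x. x \<in> {1..n}) ?T = ?T" "filter (\<lambda>x. x \<in> {1..n}) ?D = []"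
    "filter (\<lambda>x. x \<in> {n + 1..2 * n}) ?T = []" "filter (\<lambda>x. x \<in> {n + 1..2 * n}) ?D = ?D"
    using T D by (fastforce simp: filter_id_conv filter_empty_conv)+
  ultimately show "subword {1..n} (rev (letters 1 (map g (t @ d)))) = rev ?T"
    "subword {n + 1..2 * n} (rev (letters 1 (map g (t @ d)))) = rev ?D"
    unfolding subword_def by (simp_all only: rev_filter[symmetric] filter_append append_Nil2 append_Nil)
qed

text \<open>Sliding does not change the Knuth class, and \<open>mirror s\<close> is correctly bracketed, so it gives the
  tableau in the class of \<open>b\<^sup>\<or>\<^sup>*\<close>.\<close>
lemma schensted_tableau_vee_star:
  assumes s: "height 0 s = Some 0" "length s = 2 * n"
    and "1 \<le> length (letters 1 (map in_right s))"
    and "length (letters 1 (map in_left s)) + length (letters 1 (map in_right s)) = 2 * n"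
  shows "\<bbbP> (star n (vee n (rev (letters 1 (map in_left s)))) @
      star n (vee n (rev (letters 1 (map in_right s))))) = two_columns (mirror s)"
  unfolding star_vee_two_columns[OF s(2)]
proof (rule schensted_tableau_eqI)
  have m: "height 0 (mirror s) = Some 0" by (rule height_mirror[OF s(1)])
  show equiv: "knuth_equivalent (slid_columns (mirror s)) (two_columns (mirror s))"
    by (rule slide_knuth[OF m])
  let ?u = "rev (letters 1 (map in_left (mirror s)))" and ?v = "rev (letters 1 (map in_right (mirror s)))"
  have "length ?u + length ?v = 2 * n"
    using knuth_equivalent_length[OF equiv] length_slid_mirror[of 1 s 1] assms(2,4)
    by (simp add: slid_columns_def two_columns_def)
  then have "?u \<noteq> []" "?v \<noteq> []"
    using height_length[OF m, of 1] height_length[OF s(1), of 1] assms(3,4)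
    by (auto simp: count_list_mirror simp flip: length_greater_0_conv)
  then have "tableau_columns [?u, ?v]"
    using height_tableau[OF m, of 1] by (simp add: tableau_columns_def column_word_letters)
  then show "tableau (two_columns (mirror s))"
    unfolding tableau_def two_columns_def by (intro exI[of _ "[?u, ?v]"]) simp
qed

lemma two_column_tableau_symbols:
  assumes "two_column_tableau u v" "set u \<subseteq> {1..m}" "set v \<subseteq> {1..m}"
  obtains s where "height 0 s = Some 0" "length s = m"
    "u = rev (letters 1 (map in_left s))" "v = rev (letters 1 (map in_right s))"
proof -
  have uv: "column_word u" "column_word v" "dominates (rev u) (rev v)"
    using assms(1) by (auto simp: two_column_tableau_iff)
  obtain us where us: "length us = m" "u = rev (letters 1 us)"
    using column_word_letters_ex[OF uv(1) assms(2)] .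
  obtain vs where vs: "length vs = m" "v = rev (letters 1 vs)"
    using column_word_letters_ex[OF uv(2) assms(3)] .
  obtain s where s: "height 0 s = Some 0" "map in_left s = us" "map in_right s = vs"
    using dominates_height[of us vs 0 1] us vs uv(3) by auto
  have "length s = m" using s(2) us(1) by auto
  with s us vs that show ?thesis by simp
qed

lemma mirror_fixed:
  assumes "mirror s = s" "length s = 2 * n"
  shows "drop n s = mirror (take n s)"
proof -
  have "mirror (drop n s) @ mirror (take n s) = take n s @ drop n s"
    using assms(1) by (metis append_take_drop_id mirror_simps(3))
  then show ?thesis using assms(2) by (subst (asm) append_eq_append_conv) auto
qed

text \<open>The second condition says that no bracket crosses the middle of the alphabet.\<close>
lemma virtual_crystal_symbols:
  assumes "r \<le> n" "height 0 s = Some 0" "length s = 2 * n" "count_list s Free = 2 * (n - r)"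
  shows "two_columns s \<in> virtual_crystal n r \<longleftrightarrow> mirror s = s \<and> height 0 (take n s) = Some 0"
proof
  assume "two_columns s \<in> virtual_crystal n r"
  then obtain t where t: "virtual_seq n r t" "two_columns s = two_columns (t @ mirror t)"
    using virtual_crystal_eq[OF assms(1)] by (auto simp: virtual_word_def)
  have "s = t @ mirror t"
    using t assms height_mirror[of 0 t 0]
    by (intro two_columns_inject) (auto simp: virtual_seq_def height_append count_list_mirror)
  then show "mirror s = s \<and> height 0 (take n s) = Some 0"
    using t(1) by (auto simp: virtual_seq_def)
next
  assume s: "mirror s = s \<and> height 0 (take n s) = Some 0"
  let ?t = "take n s"
  have sym: "s = ?t @ mirror ?t"
    using mirror_fixed[OF _ assms(3)] s append_take_drop_id[of n s] by metis
  then have "count_list s Free = 2 * count_list ?t Free"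
    by (metis count_list_append count_list_mirror mult_2)
  then have "virtual_seq n r ?t" using s assms by (simp add: virtual_seq_def)
  then show "two_columns s \<in> virtual_crystal n r"
    using virtual_word_in_virtual_crystal[OF _ assms(1)] sym by (metis virtual_word_def)
qed

theorem proposition6p17:
  fixes n r :: nat and b u v u1 u2 v1 v2 :: word
  assumes "n \<ge> 1" and "1 \<le> r" and "r \<le> n"
    and "two_column_tableau u v"
    and "set u \<subseteq> {1..2 * n}" and "set v \<subseteq> {1..2 * n}"
    and "length u = 2 * n - r" and "length v = r"
    and "b = u @ v"
    and "u1 = subword {1..n} u" and "u2 = subword {n + 1..2 * n} u"
    and "v1 = subword {1..n} v" and "v2 = subword {n + 1..2 * n} v"
  shows "(b \<in> virtual_crystal n r \<longleftrightarrow>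
           \<bbbP> (star n (vee n u) @ star n (vee n v)) = b \<and> two_column_tableau u1 v1 \<and>
           int (length u1) - int (length v1) = int n - int r)
       \<and> (b \<in> virtual_crystal n r \<longleftrightarrow>
           \<bbbP> (star n (vee n u) @ star n (vee n v)) = b \<and> two_column_tableau u2 v2 \<and>
           int (length u2) - int (length v2) = int n - int r)"
proof -
  obtain s where s: "height 0 s = Some 0" "length s = 2 * n"
    "u = rev (letters 1 (map in_left s))" "v = rev (letters 1 (map in_right s))"
    using two_column_tableau_symbols[OF assms(4-6)] .
  have b: "b = two_columns s" using assms(9) s by (simp add: two_columns_def)
  have free: "count_list s Free = 2 * (n - r)"
    using height_length[OF s(1), of 1] assms(3,7,8) s(3,4) by simp
  have P: "\<bbbP> (star n (vee n u) @ star n (vee n v)) = two_columns (mirror s)"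
    unfolding s(3,4)
    by (rule schensted_tableau_vee_star) (use s assms(2,3,7,8) in auto)
  have fixed: "\<bbbP> (star n (vee n u) @ star n (vee n v)) = b \<longleftrightarrow> mirror s = s"
    unfolding P b
    using two_columns_inject[OF height_mirror[OF s(1)] s(1)] by (auto simp: count_list_mirror)
  define t d where "t = take n s" and "d = drop n s"
  have td: "s = t @ d" "length t = n" "length d = n" using s(2) by (simp_all add: t_def d_def)
  obtain h where h: "height 0 t = Some h" "height h d = Some 0"
    using s(1) unfolding td(1) height_append by (auto simp: bind_eq_Some_conv)
  \<comment> \<open>\<open>h\<close> is the number of brackets that cross the middle of the alphabet; for symmetric \<open>s\<close>, each of the length conditions says \<open>h = 0\<close>\<close>
  have crystal: "b \<in> virtual_crystal n r \<longleftrightarrow> mirror s = s \<and> h = 0"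
    using virtual_crystal_symbols[OF assms(3) s(1,2) free] h(1) by (simp add: b t_def)
  have u1: "u1 = rev (letters 1 (map in_left t))" and v1: "v1 = rev (letters 1 (map in_right t))"
    and u2: "u2 = rev (letters (n + 1) (map in_left d))" and v2: "v2 = rev (letters (n + 1) (map in_right d))"
    using subword_letters[OF td(2,3)] unfolding assms(10-13) s(3,4) td(1) by simp_all
  have "int (length u1) - int (length v1) = int n - int r \<longleftrightarrow> h = 0"
    "int (length u2) - int (length v2) = int n - int r \<longleftrightarrow> h = 0" if "mirror s = s"
  proof -
    have "d = mirror t" using mirror_fixed[OF that s(2)] by (simp add: t_def d_def)
    then have "count_list t Free = n - r" "count_list d Free = n - r"
      using free unfolding td(1) by (simp_all add: count_list_mirror)
    then show "int (length u1) - int (length v1) = int n - int r \<longleftrightarrow> h = 0"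
      "int (length u2) - int (length v2) = int n - int r \<longleftrightarrow> h = 0"
      using height_length[OF h(1), of 1] height_length[OF h(2), of "n + 1"] assms(3)
      unfolding u1 v1 u2 v2 by auto
  qed
  moreover have "two_column_tableau u1 v1" unfolding u1 v1 by (rule height_tableau[OF h(1)])
  moreover have "two_column_tableau u2 v2" if "h = 0"
    using height_tableau h(2) unfolding u2 v2 that by blast
  ultimately show ?thesis using crystal fixed by blast
qed

end
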